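(* In the optical flow setting described in the context, for all $\delta>0$ let $\alpha=\alpha(\delta)>0$ with $\alpha(\delta)\to0$ as $\delta\searrow0$, and let the measured displacement fields satisfy $v^k_\delta\in\mathcal{V}$ for all $k\in\mathbb{N}$, $\delta>0$, for a set $\mathcal{V}\subset V$ of bijective displacement fields such that $$\Lambda_{\mathcal{V}}:=\sup_{v\in\mathcal{V},\,\xi\in\Omega}|\det\nabla v^{-1}(\xi)|<2.$$ With the ground-truth images satisfying $\bar b^{0:\infty}\in\mathcal{B}$, assume: (I) $\sup_{k\in\mathbb{N}}\|b^k_\delta-\bar b^k\|_{L^2(\Omega)}\to0$ and $\sup_{k\in\mathbb{N}}\|v^k_\delta-\bar v^k\|_{L^2(\Omega;\mathbb{R}^2)}\to0$ as $\delta\searrow0$. (II) For some $\Lambda>\Lambda_{\mathcal{V}}$ and $\kappa\in(0,1)$, the step length parameters $\tau_k\equiv\tau>0$, $\sigma_k\equiv\sigma>0$, $\tilde\sigma_k\equiv\tilde\sigma=\Lambda\sigma/\kappa$ and the factor $\tilde\rho_k\equiv\tilde\rho$ are independent of $\delta$ and $k$ and satisfy $$\tilde\rho\ge\frac{1}{2\sigma}\Bigl(1-\frac{\kappa}{\Lambda}\Bigr),\qquad 1+\tau\ge\Lambda+\frac{\tau\sigma\|D\|^2}{1-\kappa},\qquad 1\ge\tau\sigma\|D\|^2.$$ For an initial $u^0=u^0_\delta\in X\times Y$, for all $\delta>0$, generate $u^{k}_\delta=(x^k_\delta,y^k_\delta)$, $k\ge1$, by the algorithm (POPD) of the context. Then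 there exist $\bar N(\delta)\in\mathbb{N}$ such that: (a) $\displaystyle\lim_{\delta\searrow0}\ \sup_{N\ge\bar N(\delta)}\ \frac1N\sum_{k=1}^N\|x^k_\delta-\bar b^k\|^2_{L^2(\Omega)}=0$; and (b) provided $\tau\sigma\|D\|^2<1$, moreover, $\displaystyle\lim_{\delta\searrow0}\ \sup_{N\ge\bar N(\delta)}\ \frac1{2N}\sum_{k=0}^{N-1}\|x^{k+1}_\delta-x^k_\delta\circ v^k_\delta\|^2_{L^2(\Omega)}=0$.
   Context: Setting. $\Omega\subset\mathbb{R}^2$ is a domain; $X\subset L^2(\Omega)$, $Y\subset L^2(\Omega;\mathbb{R}^2)$ and $V\subset L^2(\Omega;\Omega)\cap C^2(\Omega;\Omega)$ are finite-dimensional (discretisation) spaces, equipped with the $L^2$-norm. $D:X\to Y$ is a (bounded linear) discretised differential operator, with adjoint $D^*$. $\delta>0$ is the noise level; $b^k_\delta\in X$ is a noisy measurement of the true image $\bar b^k\in X$, and $v^k_\delta\in V$ a bijective noisy measurement of the true displacement field $\bar v^k\in V$, where also $\bar v^k\in H^1(\mathbb{R}^2;\mathbb{R}^2)$ ($k\in\mathbb{N}=\{0,1,2,\ldots\}$). It is understood that composition with $v^k_\delta$ maps $X$ to $X$ and $Y$ to $Y$, and that the inverses of fields in $\mathcal{V}$ are differentiable. $\|f\|_{p,q}:=\bigl\|\xi\mapsto\|f(\xi)\|_p\bigr\|_{L^q}$. $\delta_A$ denotes the $\{0,\infty\}$-valued indicator function of a set $A$. $\mathrm{prox}_F(x):=\arg\min_{\tilde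 x}F(\tilde x)+\frac12\|\tilde x-x\|^2$. Functions. $F^\delta_k(x):=\frac12\|b^k_\delta-x\|^2_X$, $(G^\alpha_k)^*(y):=\delta_{\alpha B}(y)$ with $B:=\{y\in Y\mid\|y\|_{2,\infty}\le1\}$, $K_k=D$, and $\tilde G_k^*:=(G_k^\alpha)^*+\frac{\tilde\rho}{2}\|\cdot\|^2_{L^2(\Omega)}$, all with $\alpha=\alpha(\delta)$. Algorithm (POPD). Starting from $u^0_\delta=(x^0_\delta,y^0_\delta)$, for $k\in\mathbb{N}$ (index $\delta$ on all iterates suppressed): $\xi^{k+1}:=x^k\circ v^k_\delta$; $\upsilon^{k+1}:=\mathrm{prox}_{\tilde\sigma\tilde G^*_{k+1}}(y^k\circ v^k_\delta+\tilde\sigma D\xi^{k+1})$; $x^{k+1}:=\mathrm{prox}_{\tau F^\delta_{k+1}}(\xi^{k+1}-\tau D^*\upsilon^{k+1})$; $y^{k+1}:=\mathrm{prox}_{\sigma(G^\alpha_{k+1})^*}(\upsilon^{k+1}+\sigma D(2x^{k+1}-\xi^{k+1}))$. The initial iterate $u^0_\delta=u^0$ is the same for all $\delta$. Comparison set. Let $\mathcal{U}_0\subset X\times Y$ be bounded and $M>0$. $\mathcal{U}$ is the set of sequences $\bar u^{0:\infty}=(\bar x^k,\bar y^k)_{k\ge0}$ with $\bar u^0\in\mathcal{U}_0$ and, for all $k\ge0$: $\bar x^k\in H^1(\mathbb{R}^2)$, $\bar y^k\in H^1(\mathbb{R}^2;\mathbb{R}^2)$, $\|\nabla\bar x^k\|_{2,\infty}^2\le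 M$, $\|\nabla\bar y^k\|^2_{2,\infty}\le M$, $\bar x^{k+1}=\bar x^k\circ\bar v^k$, and $\bar y^{k+1}=\mathrm{prox}_{\tilde\sigma\tilde G^*_{k+1}}(\bar y^k\circ\bar v^k+\tilde\sigma D\bar x^{k+1})$. By a slight abuse of notation the elements of $\mathcal{U}$ are identified with their restrictions to $\Omega$, which are elements of $X\times Y$, and the recursion for $\bar y^{k+1}$ and the condition $\bar u^0\in\mathcal{U}_0$ are understood for these restrictions. $\mathcal{B}:=\{\bar x^{0:\infty}\mid\bar u^{0:\infty}\in\mathcal{U}\}$. ($\mathcal{U}$ depends on $\delta$ through $\alpha(\delta)$; $\bar b^{0:\infty}\in\mathcal{B}$ is assumed for every $\delta>0$.) *)

theory Defs
  imports "HOL-Analysis.Analysis" "HOL-Probability.Essential_Supremum"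
begin

text \<open>
  Elements of \<open>L\<^sup>2(\<Omega>)\<close> are represented by functions on the whole plane of which only the values
  on \<open>\<Omega>\<close>, up to null sets, matter. Accordingly an equation between elements of \<open>L\<^sup>2(\<Omega>)\<close> is
  \<open>ae_eq \<Omega>\<close>, the norm is a seminorm on representatives, and the restriction of a function on
  the plane to \<open>\<Omega>\<close> is represented by the function itself.
\<close>

type_synonym plane = "real^2"

definition L2 :: "plane set \<Rightarrow> (plane \<Rightarrow> 'b::euclidean_space) set" where
  "L2 \<Omega> = {f \<in> borel_measurable (lebesgue_on \<Omega>). integrable (lebesgue_on \<Omega>) (\<lambda>\<xi>. (norm (f \<xi>))\<^sup>2)}"

definition ae_eq :: "plane set \<Rightarrow> (plane \<Rightarrow> 'b) \<Rightarrow> (plane \<Rightarrow> 'b) \<Rightarrow> bool" where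
  "ae_eq \<Omega> f g \<longleftrightarrow> (AE \<xi> in lebesgue_on \<Omega>. f \<xi> = g \<xi>)"

definition L2_inner :: "plane set \<Rightarrow> (plane \<Rightarrow> 'b::euclidean_space) \<Rightarrow> (plane \<Rightarrow> 'b) \<Rightarrow> real" where
  "L2_inner \<Omega> f g = (\<integral>\<xi>. f \<xi> \<bullet> g \<xi> \<partial>lebesgue_on \<Omega>)"

definition L2_norm :: "plane set \<Rightarrow> (plane \<Rightarrow> 'b::euclidean_space) \<Rightarrow> real" where
  "L2_norm \<Omega> f = sqrt (\<integral>\<xi>. (norm (f \<xi>))\<^sup>2 \<partial>lebesgue_on \<Omega>)"

text \<open>The norm \<open>\<parallel>f\<parallel>\<^bsub>2,\<infinity>\<^esub>\<close>; for matrix fields the pointwise norm is the Frobenius norm.\<close>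

definition norm_2_inf :: "plane set \<Rightarrow> (plane \<Rightarrow> 'b::real_normed_vector) \<Rightarrow> ereal" where
  "norm_2_inf \<Omega> f = esssup (lebesgue_on \<Omega>) (\<lambda>\<xi>. ereal (norm (f \<xi>)))"

text \<open>Finite-dimensional subspaces of \<open>L\<^sup>2(\<Omega>)\<close>, as sets of representatives.\<close>

definition fin_dim_L2_subspace :: "plane set \<Rightarrow> (plane \<Rightarrow> 'b::euclidean_space) set \<Rightarrow> bool" where
  "fin_dim_L2_subspace \<Omega> X \<longleftrightarrow>
     (\<exists>B. finite B \<and> B \<subseteq> L2 \<Omega> \<and>
          X = {f \<in> L2 \<Omega>. \<exists>c. ae_eq \<Omega> f (\<lambda>\<xi>. \<Sum>b\<in>B. c b *\<^sub>R b \<xi>)})"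

text \<open>\<open>Ck_on k S f\<close>: \<open>f\<close> is of class \<open>C\<^sup>k\<close> on the open set \<open>S\<close>.\<close>

fun Ck_on :: "nat \<Rightarrow> plane set \<Rightarrow> (plane \<Rightarrow> 'b::real_normed_vector) \<Rightarrow> bool" where
  "Ck_on 0 S f \<longleftrightarrow> continuous_on S f"
| "Ck_on (Suc k) S f \<longleftrightarrow> (\<forall>x\<in>S. f differentiable (at x)) \<and>
     (\<forall>i::2. Ck_on k S (\<lambda>x. frechet_derivative f (at x) (axis i 1)))"

text \<open>
  Displacement spaces: subsets of \<open>L\<^sup>2(\<Omega>;\<Omega>) \<inter> C\<^sup>2(\<Omega>;\<Omega>)\<close>. As the values lie in \<open>\<Omega>\<close>, such a set is
  not a linear space; finite-dimensional means that it lies in the span of finitely many fields.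
  Its members are genuine functions on \<open>\<Omega>\<close>; the last conjunct says that values outside \<open>\<Omega>\<close> are
  immaterial.
\<close>

definition displacement_space :: "plane set \<Rightarrow> (plane \<Rightarrow> plane) set \<Rightarrow> bool" where
  "displacement_space \<Omega> V \<longleftrightarrow>
     (\<forall>v\<in>V. v \<in> L2 \<Omega> \<and> Ck_on 2 \<Omega> v \<and> v ` \<Omega> \<subseteq> \<Omega>) \<and>
     (\<exists>B. finite B \<and> (\<forall>v\<in>V. \<exists>c. \<forall>\<xi>\<in>\<Omega>. v \<xi> = (\<Sum>b\<in>B. c b *\<^sub>R b \<xi>))) \<and>
     (\<forall>v\<in>V. \<forall>w. (\<forall>\<xi>\<in>\<Omega>. w \<xi> = v \<xi>) \<longrightarrow> w \<in> V)"

text \<open>\<open>\<Lambda>\<^sub>V = sup \<bar>det \<nabla>v\<^sup>-\<^sup>1(\<xi>)\<bar>\<close> over \<open>v \<in> VV\<close> and \<open>\<xi> \<in> \<Omega>\<close>.\<close>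

definition Lambda_sup :: "plane set \<Rightarrow> (plane \<Rightarrow> plane) set \<Rightarrow> ereal" where
  "Lambda_sup \<Omega> VV = (SUP v\<in>VV. SUP \<xi>\<in>\<Omega>. ereal \<bar>det (jacobian (inv_into \<Omega> v) (at \<xi>))\<bar>)"

text \<open>
  Weak gradients on the plane, with \<open>C\<^sup>1\<close> test functions of compact support (Brezis' convention;
  smooth test functions give the same notion). Row \<open>i\<close> of \<open>g \<xi>\<close> is the \<open>i\<close>-th partial derivative.
\<close>

definition has_weak_gradient ::
  "(plane \<Rightarrow> 'b::euclidean_space) \<Rightarrow> (plane \<Rightarrow> 'b^2) \<Rightarrow> bool" where
  "has_weak_gradient f g \<longleftrightarrow>
     (\<forall>\<phi>::plane \<Rightarrow> real. Ck_on 1 UNIV \<phi> \<and> compact (closure {\<xi>. \<phi> \<xi> \<noteq> 0}) \<longrightarrow>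
        (\<forall>i. (\<integral>\<xi>. frechet_derivative \<phi> (at \<xi>) (axis i 1) *\<^sub>R f \<xi> \<partial>lebesgue_on UNIV)
             = - (\<integral>\<xi>. \<phi> \<xi> *\<^sub>R (g \<xi> $ i) \<partial>lebesgue_on UNIV)))"

definition H1_gradient :: "(plane \<Rightarrow> 'b::euclidean_space) \<Rightarrow> (plane \<Rightarrow> 'b^2) \<Rightarrow> bool" where
  "H1_gradient f g \<longleftrightarrow> f \<in> L2 UNIV \<and> g \<in> L2 UNIV \<and> has_weak_gradient f g"

definition H1 :: "(plane \<Rightarrow> 'b::euclidean_space) set" where
  "H1 = {f. \<exists>g. H1_gradient f g}"

text \<open>
  \<open>D : X \<rightarrow> Y\<close> is a bounded linear operator of \<open>L\<^sup>2\<close>-spaces. It acts on representatives; linearity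
  and boundedness together force it to respect equality almost everywhere.
\<close>

definition bounded_linear_op ::
  "plane set \<Rightarrow> (plane \<Rightarrow> 'a::euclidean_space) set \<Rightarrow> (plane \<Rightarrow> 'b::euclidean_space) set
     \<Rightarrow> ((plane \<Rightarrow> 'a) \<Rightarrow> (plane \<Rightarrow> 'b)) \<Rightarrow> bool" where
  "bounded_linear_op \<Omega> X Y D \<longleftrightarrow>
     (\<forall>f\<in>X. D f \<in> Y) \<and>
     (\<forall>f\<in>X. \<forall>g\<in>X. ae_eq \<Omega> (D (\<lambda>\<xi>. f \<xi> + g \<xi>)) (\<lambda>\<xi>. D f \<xi> + D g \<xi>)) \<and>
     (\<forall>f\<in>X. \<forall>c. ae_eq \<Omega> (D (\<lambda>\<xi>. c *\<^sub>R f \<xi>)) (\<lambda>\<xi>. c *\<^sub>R D f \<xi>)) \<and>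
     (\<exists>C. \<forall>f\<in>X. L2_norm \<Omega> (D f) \<le> C * L2_norm \<Omega> f)"

definition adjoint_op ::
  "plane set \<Rightarrow> (plane \<Rightarrow> 'a::euclidean_space) set \<Rightarrow> (plane \<Rightarrow> 'b::euclidean_space) set
     \<Rightarrow> ((plane \<Rightarrow> 'a) \<Rightarrow> (plane \<Rightarrow> 'b)) \<Rightarrow> ((plane \<Rightarrow> 'b) \<Rightarrow> (plane \<Rightarrow> 'a)) \<Rightarrow> bool" where
  "adjoint_op \<Omega> X Y D Dadj \<longleftrightarrow>
     (\<forall>y\<in>Y. Dadj y \<in> X) \<and>
     (\<forall>x\<in>X. \<forall>y\<in>Y. L2_inner \<Omega> (D x) y = L2_inner \<Omega> x (Dadj y))"

definition op_norm ::
  "plane set \<Rightarrow> (plane \<Rightarrow> 'a::euclidean_space) set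
     \<Rightarrow> ((plane \<Rightarrow> 'a) \<Rightarrow> (plane \<Rightarrow> 'b::euclidean_space)) \<Rightarrow> real" where
  "op_norm \<Omega> X D = (SUP f\<in>{f \<in> X. L2_norm \<Omega> f \<le> 1}. L2_norm \<Omega> (D f))"

text \<open>
  \<open>is_prox \<Omega> Z F w p\<close>: \<open>p = prox\<^sub>F(w)\<close>, the minimiser being taken over the space \<open>Z\<close>. Minimisers
  are unique only up to null sets, so this is a relation between representatives. The point \<open>w\<close>
  is in \<open>L\<^sup>2(\<Omega>)\<close> but not necessarily in \<open>Z\<close>.
\<close>

definition is_prox ::
  "plane set \<Rightarrow> (plane \<Rightarrow> 'b::euclidean_space) set \<Rightarrow> ((plane \<Rightarrow> 'b) \<Rightarrow> ereal)
     \<Rightarrow> (plane \<Rightarrow> 'b) \<Rightarrow> (plane \<Rightarrow> 'b) \<Rightarrow> bool" where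
  "is_prox \<Omega> Z F w p \<longleftrightarrow> w \<in> L2 \<Omega> \<and>
     is_arg_min (\<lambda>z. F z + ereal (1/2 * (L2_norm \<Omega> (\<lambda>\<xi>. z \<xi> - w \<xi>))\<^sup>2)) (\<lambda>z. z \<in> Z) p"

definition indicator_fun :: "'a set \<Rightarrow> 'a \<Rightarrow> ereal" where
  "indicator_fun A z = (if z \<in> A then 0 else \<infinity>)"

definition dual_ball :: "plane set \<Rightarrow> (plane \<Rightarrow> plane) set \<Rightarrow> (plane \<Rightarrow> plane) set" where
  "dual_ball \<Omega> Y = {y \<in> Y. norm_2_inf \<Omega> y \<le> 1}"

definition Ffun :: "plane set \<Rightarrow> (plane \<Rightarrow> real) \<Rightarrow> (plane \<Rightarrow> real) \<Rightarrow> ereal" where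
  "Ffun \<Omega> b x = ereal (1/2 * (L2_norm \<Omega> (\<lambda>\<xi>. b \<xi> - x \<xi>))\<^sup>2)"

definition Gconj :: "plane set \<Rightarrow> (plane \<Rightarrow> plane) set \<Rightarrow> real \<Rightarrow> (plane \<Rightarrow> plane) \<Rightarrow> ereal" where
  "Gconj \<Omega> Y \<alpha> = indicator_fun ((\<lambda>y \<xi>. \<alpha> *\<^sub>R y \<xi>) ` dual_ball \<Omega> Y)"

definition Gconj_pred ::
  "plane set \<Rightarrow> (plane \<Rightarrow> plane) set \<Rightarrow> real \<Rightarrow> real \<Rightarrow> (plane \<Rightarrow> plane) \<Rightarrow> ereal" where
  "Gconj_pred \<Omega> Y \<alpha> \<rho>t y = Gconj \<Omega> Y \<alpha> y + ereal (\<rho>t / 2 * (L2_norm \<Omega> y)\<^sup>2)"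

text \<open>
  The algorithm, for fixed noise level: \<open>b\<close>, \<open>v\<close> are the measured images and displacements,
  \<open>\<sigma>t\<close>, \<open>\<rho>t\<close> the prediction parameters. \<open>\<xi>\<^sup>k\<^sup>+\<^sup>1\<close> is written out as \<open>x k \<circ> v k\<close>.
\<close>

definition POPD ::
  "plane set \<Rightarrow> (plane \<Rightarrow> real) set \<Rightarrow> (plane \<Rightarrow> plane) set
     \<Rightarrow> ((plane \<Rightarrow> real) \<Rightarrow> (plane \<Rightarrow> plane)) \<Rightarrow> ((plane \<Rightarrow> plane) \<Rightarrow> (plane \<Rightarrow> real))
     \<Rightarrow> real \<Rightarrow> real \<Rightarrow> real \<Rightarrow> real \<Rightarrow> real
     \<Rightarrow> (nat \<Rightarrow> plane \<Rightarrow> real) \<Rightarrow> (nat \<Rightarrow> plane \<Rightarrow> plane)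
     \<Rightarrow> (nat \<Rightarrow> plane \<Rightarrow> real) \<Rightarrow> (nat \<Rightarrow> plane \<Rightarrow> plane) \<Rightarrow> bool" where
  "POPD \<Omega> X Y D Dadj \<tau> \<sigma> \<sigma>t \<rho>t \<alpha> b v x y \<longleftrightarrow>
     (\<forall>k. \<exists>\<upsilon>.
        is_prox \<Omega> Y (\<lambda>z. ereal \<sigma>t * Gconj_pred \<Omega> Y \<alpha> \<rho>t z)
          (\<lambda>\<xi>. y k (v k \<xi>) + \<sigma>t *\<^sub>R D (x k \<circ> v k) \<xi>) \<upsilon> \<and>
        is_prox \<Omega> X (\<lambda>z. ereal \<tau> * Ffun \<Omega> (b (Suc k)) z)
          (\<lambda>\<xi>. x k (v k \<xi>) - \<tau> * Dadj \<upsilon> \<xi>) (x (Suc k)) \<and>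
        is_prox \<Omega> Y (\<lambda>z. ereal \<sigma> * Gconj \<Omega> Y \<alpha> z)
          (\<lambda>\<xi>. \<upsilon> \<xi> + \<sigma> *\<^sub>R D (\<lambda>\<eta>. 2 * x (Suc k) \<eta> - x k (v k \<eta>)) \<xi>) (y (Suc k)))"

text \<open>
  The comparison set. A field on the plane with essentially bounded weak gradient has a (Lipschitz)
  continuous representative, and this is the one listed here: the true displacements \<open>vbar k\<close> need
  not be bijective, so that composition with them is not defined on classes of functions.
\<close>

definition comparison_set ::
  "plane set \<Rightarrow> (plane \<Rightarrow> real) set \<Rightarrow> (plane \<Rightarrow> plane) set
     \<Rightarrow> ((plane \<Rightarrow> real) \<Rightarrow> (plane \<Rightarrow> plane))
     \<Rightarrow> real \<Rightarrow> ((plane \<Rightarrow> real) \<times> (plane \<Rightarrow> plane)) set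
     \<Rightarrow> (nat \<Rightarrow> plane \<Rightarrow> plane) \<Rightarrow> real \<Rightarrow> real \<Rightarrow> real
     \<Rightarrow> ((nat \<Rightarrow> plane \<Rightarrow> real) \<times> (nat \<Rightarrow> plane \<Rightarrow> plane)) set" where
  "comparison_set \<Omega> X Y D M U0 vbar \<sigma>t \<rho>t \<alpha> = {(x, y).
     (\<exists>(x0, y0)\<in>U0. ae_eq \<Omega> (x 0) x0 \<and> ae_eq \<Omega> (y 0) y0) \<and>
     (\<forall>k. x k \<in> X \<and> y k \<in> Y \<and>
          continuous_on UNIV (x k) \<and> continuous_on UNIV (y k) \<and>
          (\<exists>g. H1_gradient (x k) g \<and> (norm_2_inf UNIV g)\<^sup>2 \<le> ereal M) \<and>
          (\<exists>g. H1_gradient (y k) g \<and> (norm_2_inf UNIV g)\<^sup>2 \<le> ereal M) \<and>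
          ae_eq UNIV (x (Suc k)) (x k \<circ> vbar k) \<and>
          is_prox \<Omega> Y (\<lambda>z. ereal \<sigma>t * Gconj_pred \<Omega> Y \<alpha> \<rho>t z)
            (\<lambda>\<xi>. y k (vbar k \<xi>) + \<sigma>t *\<^sub>R D (x (Suc k)) \<xi>) (y (Suc k)))}"

definition image_comparison_set ::
  "plane set \<Rightarrow> (plane \<Rightarrow> real) set \<Rightarrow> (plane \<Rightarrow> plane) set
     \<Rightarrow> ((plane \<Rightarrow> real) \<Rightarrow> (plane \<Rightarrow> plane))
     \<Rightarrow> real \<Rightarrow> ((plane \<Rightarrow> real) \<times> (plane \<Rightarrow> plane)) set
     \<Rightarrow> (nat \<Rightarrow> plane \<Rightarrow> plane) \<Rightarrow> real \<Rightarrow> real \<Rightarrow> real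
     \<Rightarrow> (nat \<Rightarrow> plane \<Rightarrow> real) set" where
  "image_comparison_set \<Omega> X Y D M U0 vbar \<sigma>t \<rho>t \<alpha> =
     {b. \<exists>(x, y)\<in>comparison_set \<Omega> X Y D M U0 vbar \<sigma>t \<rho>t \<alpha>. \<forall>k. ae_eq \<Omega> (b k) (x k)}"

end

theory Submission
  imports Defs
begin

text \<open>
  Since \<open>\<alpha>(\<delta>) \<rightarrow> 0\<close>, the dual variables are negligible: \<open>\<upsilon>\<^sup>k\<^sup>+\<^sup>1\<close> lies in \<open>\<alpha>B\<close>, and \<open>\<Omega>\<close> has finite measure,
  so \<open>D\<^sup>*\<upsilon>\<^sup>k\<^sup>+\<^sup>1 = O(\<alpha>)\<close> in \<open>L\<^sup>2\<close>. The primal step averages,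
  \<open>x\<^sup>k\<^sup>+\<^sup>1 = (x\<^sup>k \<circ> v\<^sup>k - \<tau>D\<^sup>*\<upsilon>\<^sup>k\<^sup>+\<^sup>1 + \<tau>b\<^sup>k\<^sup>+\<^sup>1) / (1 + \<tau>)\<close>.
  Composition with \<open>v\<^sup>k\<close> has \<open>L\<^sup>2\<close>-norm at most \<open>\<surd>\<Lambda>\<close>, and the true images are \<open>\<surd>M\<close>-Lipschitz, so
  replacing \<open>v\<^sup>k\<close> by the true displacement costs \<open>\<surd>M\<close> times the displacement noise. Hence the error
  \<open>e\<^sub>k\<close> between \<open>x\<^sup>k\<close> and the true image satisfies \<open>e\<^sub>k\<^sub>+\<^sub>1 \<le> q e\<^sub>k + o(1)\<close> uniformly in \<open>k\<close>, where
  \<open>q = \<surd>\<Lambda> / (1 + \<tau>) < 1\<close> because \<open>\<Lambda> \<le> 1 + \<tau>\<close>.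
\<close>

section \<open>The space of square integrable functions\<close>

lemma L2_D:
  assumes "f \<in> L2 \<Omega>"
  shows "f \<in> borel_measurable (lebesgue_on \<Omega>)" "integrable (lebesgue_on \<Omega>) (\<lambda>\<xi>. (norm (f \<xi>))\<^sup>2)"
  using assms by (auto simp: L2_def)

text \<open>If the square of \<open>f\<close> is not integrable, its Bochner integral is 0 by
  convention, so the comparison holds for such \<open>f\<close> too.\<close>

lemma L2_norm_mono:
  fixes f :: "plane \<Rightarrow> 'b::euclidean_space" and g :: "plane \<Rightarrow> 'c::euclidean_space"
  assumes "g \<in> L2 \<Omega>" "AE \<xi> in lebesgue_on \<Omega>. norm (f \<xi>) \<le> norm (g \<xi>)"
  shows "L2_norm \<Omega> f \<le> L2_norm \<Omega> g"
  unfolding L2_norm_def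
  by (rule real_sqrt_le_mono, rule integral_mono_AE', rule L2_D(2)[OF assms(1)])
     (use assms in \<open>auto elim!: AE_mp intro!: power_mono\<close>)

lemma L2_norm_cong:
  assumes "ae_eq \<Omega> f g"
    and "f \<in> borel_measurable (lebesgue_on \<Omega>)" "g \<in> borel_measurable (lebesgue_on \<Omega>)"
  shows "L2_norm \<Omega> f = L2_norm \<Omega> g"
  unfolding L2_norm_def
  using assms by (intro arg_cong[where f=sqrt] integral_cong_AE) (auto simp: ae_eq_def)

lemma L2_norm_nonneg [simp]: "0 \<le> L2_norm \<Omega> f"
  by (simp add: L2_norm_def)

lemma L2_norm_power2: "(L2_norm \<Omega> f)\<^sup>2 = (\<integral>\<xi>. (norm (f \<xi>))\<^sup>2 \<partial>lebesgue_on \<Omega>)"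
  by (simp add: L2_norm_def)

lemma L2_scaleR:
  assumes "f \<in> L2 \<Omega>" shows "(\<lambda>\<xi>. c *\<^sub>R f \<xi>) \<in> L2 \<Omega>"
  using assms by (auto simp: L2_def power_mult_distrib)

lemma L2_norm_scaleR: "L2_norm \<Omega> (\<lambda>\<xi>. c *\<^sub>R f \<xi>) = \<bar>c\<bar> * L2_norm \<Omega> f"
  by (simp add: L2_norm_def power_mult_distrib real_sqrt_mult)

lemma L2_integrable_mult:
  fixes f :: "plane \<Rightarrow> 'b::euclidean_space" and g :: "plane \<Rightarrow> 'c::euclidean_space"
  assumes f: "f \<in> L2 \<Omega>" and g: "g \<in> L2 \<Omega>"
  shows "integrable (lebesgue_on \<Omega>) (\<lambda>\<xi>. norm (f \<xi>) * norm (g \<xi>))"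
proof (rule Bochner_Integration.integrable_bound)
  show "integrable (lebesgue_on \<Omega>) (\<lambda>\<xi>. (norm (f \<xi>))\<^sup>2 + (norm (g \<xi>))\<^sup>2)"
    using L2_D(2)[OF f] L2_D(2)[OF g] by auto
  have "norm (norm (f \<xi>) * norm (g \<xi>)) \<le> norm ((norm (f \<xi>))\<^sup>2 + (norm (g \<xi>))\<^sup>2)" for \<xi>
  proof -
    have "0 \<le> norm (f \<xi>) * norm (g \<xi>)" by simp
    then show ?thesis using sum_squares_bound[of "norm (f \<xi>)" "norm (g \<xi>)"]
      unfolding real_norm_def by linarith
  qed
  then show "AE \<xi> in lebesgue_on \<Omega>.
      norm (norm (f \<xi>) * norm (g \<xi>)) \<le> norm ((norm (f \<xi>))\<^sup>2 + (norm (g \<xi>))\<^sup>2)" by blast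
qed (use L2_D(1)[OF f] L2_D(1)[OF g] in measurable)

text \<open>The integral of \<open>(t * norm (f \<xi>) - norm (g \<xi>))\<^sup>2\<close> is
  nonnegative for every real \<open>t\<close>; this is a quadratic inequality in \<open>t\<close>,
  into which a suitable \<open>t\<close> is inserted.\<close>

lemma L2_Cauchy_Schwarz:
  fixes f :: "plane \<Rightarrow> 'b::euclidean_space" and g :: "plane \<Rightarrow> 'c::euclidean_space"
  assumes f: "f \<in> L2 \<Omega>" and g: "g \<in> L2 \<Omega>"
  shows "(\<integral>\<xi>. norm (f \<xi>) * norm (g \<xi>) \<partial>lebesgue_on \<Omega>) \<le> L2_norm \<Omega> f * L2_norm \<Omega> g"
proof -
  let ?I = "\<lambda>h. integral\<^sup>L (lebesgue_on \<Omega>) h"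
  define A B C where "A = ?I (\<lambda>\<xi>. (norm (f \<xi>))\<^sup>2)" and "B = ?I (\<lambda>\<xi>. (norm (g \<xi>))\<^sup>2)"
    and "C = ?I (\<lambda>\<xi>. norm (f \<xi>) * norm (g \<xi>))"
  note ints = L2_D(2)[OF f] L2_D(2)[OF g] L2_integrable_mult[OF f g]
  have quad: "2 * t * C \<le> t\<^sup>2 * A + B" for t
  proof -
    have "0 \<le> ?I (\<lambda>\<xi>. (t * norm (f \<xi>) - norm (g \<xi>))\<^sup>2)" by simp
    also have "\<dots> = ?I (\<lambda>\<xi>. t\<^sup>2 * (norm (f \<xi>))\<^sup>2 + (norm (g \<xi>))\<^sup>2 - 2 * t * (norm (f \<xi>) * norm (g \<xi>)))"
      by (intro Bochner_Integration.integral_cong) (auto simp: power2_eq_square algebra_simps)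
    also have "\<dots> = t\<^sup>2 * A + B - 2 * t * C"
      using ints unfolding A_def B_def C_def by simp
    finally show ?thesis by simp
  qed
  have nn: "0 \<le> A" "0 \<le> B" "0 \<le> C" unfolding A_def B_def C_def by auto
  have "C\<^sup>2 \<le> A * B"
  proof (cases "A = 0")
    case True
    have "C = 0"
    proof (rule ccontr)
      assume "C \<noteq> 0"
      \<comment> \<open>For \<open>A = 0\<close> the inequality is linear in \<open>t\<close>, and
        this \<open>t\<close> makes its left side exceed \<open>B\<close>.\<close>
      then have "2 * (B + 1) \<le> B" using quad[of "(B + 1) / C"] True by simp
      then show False using nn by simp
    qed
    then show ?thesis using True by simp
  next
    case False
    \<comment> \<open>\<open>C / A\<close> minimises the quadratic
      \<open>t\<^sup>2 * A - 2 * t * C + B\<close>.\<close>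
    then show ?thesis using quad[of "C / A"] nn by (simp add: field_simps power2_eq_square)
  qed
  then have "C \<le> sqrt (A * B)" by (simp add: real_le_rsqrt)
  then show ?thesis by (simp add: A_def B_def C_def L2_norm_def real_sqrt_mult)
qed

lemma L2_inner_le:
  assumes f: "f \<in> L2 \<Omega>" and g: "g \<in> L2 \<Omega>"
  shows "L2_inner \<Omega> f g \<le> L2_norm \<Omega> f * L2_norm \<Omega> g"
proof -
  have "L2_inner \<Omega> f g \<le> (\<integral>\<xi>. norm (f \<xi>) * norm (g \<xi>) \<partial>lebesgue_on \<Omega>)"
    unfolding L2_inner_def
    by (rule integral_mono_AE'[OF L2_integrable_mult[OF f g]]) (auto simp: norm_cauchy_schwarz)
  with L2_Cauchy_Schwarz[OF f g] show ?thesis by linarith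
qed

text \<open>The expanded square \<open>?h\<close> of \<open>norm (f \<xi>) + norm (g \<xi>)\<close>
  serves twice: as integrable majorant it gives membership, and with the Cauchy-Schwarz inequality
  for its mixed term it gives the norm bound.\<close>

lemma
  assumes f: "f \<in> L2 \<Omega>" and g: "g \<in> L2 \<Omega>"
  shows L2_add: "(\<lambda>\<xi>. f \<xi> + g \<xi>) \<in> L2 \<Omega>"
    and L2_norm_triangle: "L2_norm \<Omega> (\<lambda>\<xi>. f \<xi> + g \<xi>) \<le> L2_norm \<Omega> f + L2_norm \<Omega> g"
proof -
  let ?I = "\<lambda>h. integral\<^sup>L (lebesgue_on \<Omega>) h"
  let ?h = "\<lambda>\<xi>. (norm (f \<xi>))\<^sup>2 + (norm (g \<xi>))\<^sup>2 + 2 * (norm (f \<xi>) * norm (g \<xi>))"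
  note ints = L2_D(2)[OF f] L2_D(2)[OF g] L2_integrable_mult[OF f g]
  have h: "integrable (lebesgue_on \<Omega>) ?h" using ints by auto
  have bd: "(norm (f \<xi> + g \<xi>))\<^sup>2 \<le> ?h \<xi>" for \<xi>
    using power_mono[OF norm_triangle_ineq[of "f \<xi>" "g \<xi>"], of 2]
    by (simp add: power2_sum algebra_simps)
  have m: "(\<lambda>\<xi>. f \<xi> + g \<xi>) \<in> borel_measurable (lebesgue_on \<Omega>)"
    using L2_D(1)[OF f] L2_D(1)[OF g] by measurable
  have "integrable (lebesgue_on \<Omega>) (\<lambda>\<xi>. (norm (f \<xi> + g \<xi>))\<^sup>2)"
    by (rule Bochner_Integration.integrable_bound[OF h]) (use m bd in \<open>auto intro: order_trans[OF _ abs_ge_self]\<close>)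
  with m show "(\<lambda>\<xi>. f \<xi> + g \<xi>) \<in> L2 \<Omega>" by (simp add: L2_def)
  have "(L2_norm \<Omega> (\<lambda>\<xi>. f \<xi> + g \<xi>))\<^sup>2 \<le> ?I ?h"
    unfolding L2_norm_power2 by (rule integral_mono_AE'[OF h]) (use bd in auto)
  also have "\<dots> = (L2_norm \<Omega> f)\<^sup>2 + (L2_norm \<Omega> g)\<^sup>2 + 2 * ?I (\<lambda>\<xi>. norm (f \<xi>) * norm (g \<xi>))"
    using ints by (simp add: L2_norm_power2)
  also have "\<dots> \<le> (L2_norm \<Omega> f + L2_norm \<Omega> g)\<^sup>2"
    using L2_Cauchy_Schwarz[OF f g] by (simp add: power2_sum)
  finally show "L2_norm \<Omega> (\<lambda>\<xi>. f \<xi> + g \<xi>) \<le> L2_norm \<Omega> f + L2_norm \<Omega> g"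
    by (rule power2_le_imp_le) simp
qed

lemma
  assumes f: "f \<in> L2 \<Omega>" and g: "g \<in> L2 \<Omega>"
  shows L2_diff: "(\<lambda>\<xi>. f \<xi> - g \<xi>) \<in> L2 \<Omega>"
    and L2_norm_triangle_diff: "L2_norm \<Omega> (\<lambda>\<xi>. f \<xi> - g \<xi>) \<le> L2_norm \<Omega> f + L2_norm \<Omega> g"
  using L2_add[OF f L2_scaleR[OF g, of "-1"]] L2_norm_triangle[OF f L2_scaleR[OF g, of "-1"]]
  by (simp_all add: L2_norm_def)

lemma L2_norm_minus_commute: "L2_norm \<Omega> (\<lambda>\<xi>. f \<xi> - g \<xi>) = L2_norm \<Omega> (\<lambda>\<xi>. g \<xi> - f \<xi>)"
  by (simp add: L2_norm_def norm_minus_commute)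

lemma L2_norm_diff_triangle:
  assumes "f \<in> L2 \<Omega>" "g \<in> L2 \<Omega>" "h \<in> L2 \<Omega>"
  shows "L2_norm \<Omega> (\<lambda>\<xi>. f \<xi> - h \<xi>) \<le> L2_norm \<Omega> (\<lambda>\<xi>. f \<xi> - g \<xi>) + L2_norm \<Omega> (\<lambda>\<xi>. g \<xi> - h \<xi>)"
  using L2_norm_triangle[OF L2_diff[OF assms(1,2)] L2_diff[OF assms(2,3)]] by simp

section \<open>Composition with displacement fields\<close>

lemma change_of_variables_real:
  fixes f :: "plane \<Rightarrow> real" and w :: "plane \<Rightarrow> plane"
  assumes S: "\<Omega> \<in> sets lebesgue"
    and d: "\<And>\<xi>. \<xi> \<in> \<Omega> \<Longrightarrow> (w has_derivative w' \<xi>) (at \<xi>)"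
    and inj: "inj_on w \<Omega>" and im: "w ` \<Omega> = \<Omega>"
    and f: "integrable (lebesgue_on \<Omega>) f"
  shows "(\<integral>\<xi>. \<bar>det (matrix (w' \<xi>))\<bar> * f (w \<xi>) \<partial>lebesgue_on \<Omega>) = (\<integral>\<xi>. f \<xi> \<partial>lebesgue_on \<Omega>)"
proof -
  \<comment> \<open>The change of variables theorem concerns functions with values in Cartesian
    spaces, so \<open>f\<close> is treated as a field of one-dimensional vectors.\<close>
  let ?F = "\<lambda>\<xi>. vec (f \<xi>) :: real^1"
  have f': "f absolutely_integrable_on \<Omega>"
    using f S by (simp add: set_integrable_def integrable_restrict_space)
  have F: "?F absolutely_integrable_on \<Omega>" "integral \<Omega> ?F = vec (integral\<^sup>L (lebesgue_on \<Omega>) f)"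
    using f f' S by (auto simp: absolutely_integrable_on_1_iff integral_on_1_eq lebesgue_integral_eq_integral
        vec_eq_iff)
  have "(\<lambda>x. \<bar>det (matrix (w' x))\<bar> *\<^sub>R ?F (w x)) absolutely_integrable_on \<Omega> \<and>
           integral \<Omega> (\<lambda>x. \<bar>det (matrix (w' x))\<bar> *\<^sub>R ?F (w x)) = vec (integral\<^sup>L (lebesgue_on \<Omega>) f)"
    using has_absolute_integral_change_of_variables[OF S _ inj, of w' ?F "vec (integral\<^sup>L (lebesgue_on \<Omega>) f)"] d F
    by (auto simp: im intro: has_derivative_at_withinI)
  then have *: "(\<lambda>x. \<bar>det (matrix (w' x))\<bar> * f (w x)) absolutely_integrable_on \<Omega>"
    "integral \<Omega> (\<lambda>x. \<bar>det (matrix (w' x))\<bar> * f (w x)) = integral\<^sup>L (lebesgue_on \<Omega>) f"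
    by (auto simp: absolutely_integrable_on_1_iff integral_on_1_eq vec_eq_iff)
  have "integrable (lebesgue_on \<Omega>) (\<lambda>\<xi>. \<bar>det (matrix (w' \<xi>))\<bar> * f (w \<xi>))"
    using * S by (simp add: absolutely_integrable_imp_integrable)
  then show "(\<integral>\<xi>. \<bar>det (matrix (w' \<xi>))\<bar> * f (w \<xi>) \<partial>lebesgue_on \<Omega>) = (\<integral>\<xi>. f \<xi> \<partial>lebesgue_on \<Omega>)"
    using * S by (simp add: lebesgue_integral_eq_integral)
qed

text \<open>The change of variables is applied to the inverse \<open>w\<close> of \<open>v\<close>, since only \<open>w\<close> has a controlled Jacobian.\<close>

lemma L2_norm_comp_le:
  fixes f :: "plane \<Rightarrow> 'b::euclidean_space"
  assumes S: "\<Omega> \<in> sets lebesgue" and v: "bij_betw v \<Omega> \<Omega>"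
    and d: "\<And>\<xi>. \<xi> \<in> \<Omega> \<Longrightarrow> inv_into \<Omega> v differentiable (at \<xi>)"
    and L: "\<And>\<xi>. \<xi> \<in> \<Omega> \<Longrightarrow> \<bar>det (jacobian (inv_into \<Omega> v) (at \<xi>))\<bar> \<le> L"
    and f: "f \<in> L2 \<Omega>" "f \<circ> v \<in> L2 \<Omega>"
  shows "L2_norm \<Omega> (f \<circ> v) \<le> sqrt L * L2_norm \<Omega> f"
proof -
  let ?w = "inv_into \<Omega> v"
  let ?J = "\<lambda>\<xi>. \<bar>det (jacobian ?w (at \<xi>))\<bar>"
  have w: "bij_betw ?w \<Omega> \<Omega>" using v by (rule bij_betw_inv_into)
  have vw: "v (?w \<xi>) = \<xi>" if "\<xi> \<in> \<Omega>" for \<xi>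
    using v that by (metis bij_betw_imp_surj_on f_inv_into_f)
  \<comment> \<open>Applied to the squared norm of \<open>f \<circ> v\<close>, the formula leaves
    plain \<open>f\<close> on the Jacobian side, since \<open>v\<close> undoes \<open>?w\<close> on
    \<open>\<Omega>\<close>.\<close>
  note cv = change_of_variables_real[OF S, of ?w "\<lambda>\<xi>. frechet_derivative ?w (at \<xi>)"
      "\<lambda>\<xi>. (norm ((f \<circ> v) \<xi>))\<^sup>2", folded jacobian_def]
  have "(L2_norm \<Omega> (f \<circ> v))\<^sup>2 = (\<integral>\<xi>. ?J \<xi> * (norm ((f \<circ> v) (?w \<xi>)))\<^sup>2 \<partial>lebesgue_on \<Omega>)"
    unfolding L2_norm_power2
    by (rule cv[symmetric])
       (use d w L2_D(2)[OF f(2)] in \<open>auto simp: bij_betw_def frechet_derivative_works[THEN iffD1]\<close>)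
  also have "\<dots> \<le> (\<integral>\<xi>. L * (norm (f \<xi>))\<^sup>2 \<partial>lebesgue_on \<Omega>)"
  proof (rule integral_mono_AE')
    show "AE \<xi> in lebesgue_on \<Omega>. ?J \<xi> * (norm ((f \<circ> v) (?w \<xi>)))\<^sup>2 \<le> L * (norm (f \<xi>))\<^sup>2"
      using L by (intro AE_I2) (auto simp: vw intro!: mult_right_mono)
    show "AE \<xi> in lebesgue_on \<Omega>. 0 \<le> L * (norm (f \<xi>))\<^sup>2"
      using order_trans[OF abs_ge_zero L] by (intro AE_I2) auto
  qed (use L2_D(2)[OF f(1)] in auto)
  also have "\<dots> = L * (L2_norm \<Omega> f)\<^sup>2" by (simp add: L2_norm_power2)
  finally have "sqrt ((L2_norm \<Omega> (f \<circ> v))\<^sup>2) \<le> sqrt (L * (L2_norm \<Omega> f)\<^sup>2)" by (rule real_sqrt_le_mono)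
  then show ?thesis by (simp add: real_sqrt_mult)
qed

text \<open>
  Where \<open>norm (v \<xi>) > 1\<close> the square integrability of \<open>v\<close> bounds the measure; the rest of \<open>\<Omega>\<close> is the
  image of a bounded set under the inverse of \<open>v\<close>.
\<close>

lemma lmeasurable_if_L2_displacement:
  assumes S: "\<Omega> \<in> sets lebesgue" and v: "bij_betw v \<Omega> \<Omega>" "v \<in> L2 \<Omega>"
    and d: "\<And>\<xi>. \<xi> \<in> \<Omega> \<Longrightarrow> inv_into \<Omega> v differentiable (at \<xi>)"
    and L: "\<And>\<xi>. \<xi> \<in> \<Omega> \<Longrightarrow> \<bar>det (jacobian (inv_into \<Omega> v) (at \<xi>))\<bar> \<le> L"
  shows "\<Omega> \<in> lmeasurable"
proof -
  let ?w = "inv_into \<Omega> v"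
  let ?A = "{\<xi> \<in> \<Omega>. (norm (v \<xi>))\<^sup>2 \<ge> 1}"
  let ?B = "\<Omega> \<inter> cball 0 1"
  have sp: "space (lebesgue_on \<Omega>) = \<Omega>" by simp
  have [measurable]: "v \<in> borel_measurable (lebesgue_on \<Omega>)" using L2_D(1)[OF v(2)] .
  have "emeasure (lebesgue_on \<Omega>) ?A \<le> ennreal ((1/1) * (\<integral>\<xi>. (norm (v \<xi>))\<^sup>2 \<partial>lebesgue_on \<Omega>))"
    using integral_Markov_inequality[OF L2_D(2)[OF v(2)], of 1] by simp
  moreover have "{\<xi> \<in> space (lebesgue_on \<Omega>). (norm (v \<xi>))\<^sup>2 \<ge> 1} \<in> sets (lebesgue_on \<Omega>)"
    by measurable
  then have A: "?A \<in> sets (lebesgue_on \<Omega>)" by simp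
  ultimately have "emeasure lebesgue ?A < \<infinity>" "?A \<in> sets lebesgue"
    using S by (auto simp: emeasure_restrict_space sets_restrict_space_iff intro: le_less_trans)
  then have "?A \<in> lmeasurable" by (simp add: fmeasurable_def)
  moreover have "?w ` ?B \<in> lmeasurable"
  proof (rule measurable_bounded_differentiable_image[where f' = "\<lambda>\<xi>. frechet_derivative ?w (at \<xi>)", folded jacobian_def])
    show B: "?B \<in> lmeasurable" using S by (metis lmeasurable_cball fmeasurable_Int_fmeasurable inf_commute)
    show dw: "(?w has_derivative frechet_derivative ?w (at \<xi>)) (at \<xi> within ?B)" if "\<xi> \<in> ?B" for \<xi>
      using d that by (auto intro!: has_derivative_at_withinI frechet_derivative_works[THEN iffD1])
    show "\<bar>det (jacobian ?w (at \<xi>))\<bar> \<le> L" if "\<xi> \<in> ?B" for \<xi> using L that by auto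
    \<comment> \<open>The Jacobian determinant of a differentiable map is measurable; bounded by
      \<open>L\<close> on a set of finite measure, it is integrable.\<close>
    have "(\<lambda>\<xi>. det (jacobian ?w (at \<xi>))) \<in> borel_measurable (lebesgue_on ?B)"
      unfolding jacobian_def by (rule borel_measurable_det_Jacobian) (use B dw in auto)
    then have "integrable (lebesgue_on ?B) (\<lambda>\<xi>. \<bar>det (jacobian ?w (at \<xi>))\<bar>)"
      using L B by (intro finite_measure.integrable_const_bound[where B = L] finite_measure_lebesgue_on) auto
    then show "(\<lambda>\<xi>. \<bar>det (jacobian ?w (at \<xi>))\<bar>) integrable_on ?B"
      using B by (intro integrable_on_lebesgue_on) auto
  qed
  ultimately have "?A \<union> ?w ` ?B \<in> lmeasurable" by (rule fmeasurable.Un)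
  moreover have "?A \<union> ?w ` ?B = \<Omega>"
  proof -
    have "\<xi> \<in> ?w ` ?B" if "\<xi> \<in> \<Omega>" "\<xi> \<notin> ?A" for \<xi>
    proof
      show "\<xi> = ?w (v \<xi>)" using v that by (simp add: bij_betw_def inv_into_f_f)
      show "v \<xi> \<in> ?B" using v that by (auto simp: bij_betw_def abs_square_le_1 intro: ccontr)
    qed
    moreover have "?w ` ?B \<subseteq> \<Omega>" using bij_betw_inv_into[OF v(1)] by (auto simp: bij_betw_def)
    ultimately show ?thesis by blast
  qed
  ultimately show ?thesis by simp
qed

section \<open>Functions with bounded weak gradient\<close>

definition bump :: "real \<Rightarrow> plane \<Rightarrow> plane \<Rightarrow> real" where
  "bump r c \<xi> = (max 0 (r\<^sup>2 - (norm (\<xi> - c))\<^sup>2))\<^sup>2"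

text \<open>Squaring smooths the kink of the positive part. This is why \<open>bump\<close> squares
  it: bumps become C^1 and hence admissible in the definition of weak gradients.\<close>

lemma has_derivative_pos_part_power2: "((\<lambda>s::real. (max 0 s)\<^sup>2) has_real_derivative 2 * max 0 s) (at s)"
proof -
  consider "s > 0" | "s < 0" | "s = 0" by linarith
  then show ?thesis
  proof cases
    case 1
    have "((\<lambda>s::real. s\<^sup>2) has_real_derivative 2 * max 0 s) (at s)"
      using 1 by (auto intro!: derivative_eq_intros)
    then show ?thesis
      by (rule has_field_derivative_transform_within_open[where S="{0<..}"]) (use 1 in auto)
  next
    case 2
    have "((\<lambda>s::real. 0) has_real_derivative 2 * max 0 s) (at s)"
      using 2 by (auto intro!: derivative_eq_intros)
    then show ?thesis
      by (rule has_field_derivative_transform_within_open[where S="{..<0}"]) (use 2 in auto)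
  next
    case 3
    \<comment> \<open>At the former kink the difference quotient is 0 or \<open>h\<close>, depending
      on the sign of \<open>h\<close>.\<close>
    have "((\<lambda>h::real. (max 0 h)\<^sup>2 / h) \<longlongrightarrow> 0) (at 0)"
    proof (rule Lim_null_comparison[of _ "\<lambda>h. \<bar>h\<bar>"])
      show "\<forall>\<^sub>F h::real in at 0. norm ((max 0 h)\<^sup>2 / h) \<le> \<bar>h\<bar>"
        by (rule always_eventually) (auto simp: max_def power2_eq_square)
    qed (auto intro!: tendsto_eq_intros)
    then show ?thesis using 3 by (simp add: has_field_derivative_iff)
  qed
qed

lemma has_derivative_bump:
  "(bump r c has_derivative (\<lambda>h. - 4 * max 0 (r\<^sup>2 - (norm (\<xi> - c))\<^sup>2) * ((\<xi> - c) \<bullet> h))) (at \<xi>)"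
proof -
  have "((\<lambda>\<xi>. r\<^sup>2 - (norm (\<xi> - c))\<^sup>2) has_derivative (\<lambda>h. - 2 * ((\<xi> - c) \<bullet> h))) (at \<xi>)"
    unfolding power2_norm_eq_inner
    by (auto intro!: derivative_eq_intros simp: inner_commute)
  from has_derivative_compose[OF this has_derivative_pos_part_power2[unfolded has_field_derivative_def]]
  show ?thesis by (simp add: bump_def[abs_def] mult_ac)
qed

lemma frechet_derivative_bump:
  "frechet_derivative (bump r c) (at \<xi>) h = - 4 * max 0 (r\<^sup>2 - (norm (\<xi> - c))\<^sup>2) * ((\<xi> - c) \<bullet> h)"
  using frechet_derivative_at[OF has_derivative_bump] by metis

lemma continuous_on_bump: "continuous_on S (bump r c)"
  unfolding bump_def by (intro continuous_intros)

lemma Ck_on_bump: "Ck_on 1 UNIV (bump r c)"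
  unfolding One_nat_def Ck_on.simps frechet_derivative_bump
  by (auto intro!: continuous_intros has_derivative_bump[THEN differentiableI])

lemma bump_nonneg [simp]: "0 \<le> bump r c \<xi>"
  by (simp add: bump_def)

lemma bump_eq_0: "r > 0 \<Longrightarrow> \<xi> \<notin> cball c r \<Longrightarrow> bump r c \<xi> = 0"
  by (auto simp: bump_def max_def dist_norm norm_minus_commute dest!: power_mono[where n=2 and a=r])

lemma compact_support_bump:
  assumes "r > 0" shows "compact (closure {\<xi>. bump r c \<xi> \<noteq> 0})"
proof -
  have "{\<xi>. bump r c \<xi> \<noteq> 0} \<subseteq> cball c r" using bump_eq_0[OF assms] by blast
  then show ?thesis by (meson bounded_cball bounded_subset compact_closure)
qed

text \<open>Links two integrals: differentiation under the integral sign is carried out for the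
  gauge integral over a fixed box, whereas weak gradients are defined by Lebesgue integrals over the
  plane.\<close>

lemma
  fixes u :: "plane \<Rightarrow> real"
  assumes u: "continuous_on UNIV u" and z: "\<And>\<xi>. \<xi> \<notin> cbox lo hi \<Longrightarrow> u \<xi> = 0"
  shows integrable_compact_support: "integrable lebesgue u"
    and integral_compact_support: "integral (cbox lo hi) u = integral\<^sup>L lebesgue u"
proof -
  have "integrable (lebesgue_on (cbox lo hi)) u"
    using continuous_on_subset[OF u] by (intro absolutely_integrable_imp_integrable absolutely_integrable_continuous) auto
  moreover have eq: "(\<lambda>\<xi>. indicator (cbox lo hi) \<xi> *\<^sub>R u \<xi>) = u"
    using z by (auto simp: fun_eq_iff indicator_def)
  ultimately show "integrable lebesgue u" "integral (cbox lo hi) u = integral\<^sup>L lebesgue u"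
    by (simp_all add: integrable_restrict_space lebesgue_integral_eq_integral[symmetric] integral_restrict_space)
qed

lemma integrable_bump_mult:
  assumes "r > 0" "continuous_on UNIV f"
  shows "integrable lebesgue (\<lambda>\<xi>. bump r c \<xi> * f \<xi>)"
proof -
  obtain lo hi where "cball c r \<subseteq> cbox lo hi" using bounded_subset_cbox_symmetric[OF bounded_cball] by metis
  then have "bump r c \<xi> * f \<xi> = 0" if "\<xi> \<notin> cbox lo hi" for \<xi>
    using that bump_eq_0[OF \<open>r > 0\<close>] by (metis mult_zero_left subsetD)
  then show ?thesis
    using assms(2) by (intro integrable_compact_support[of _ lo hi] continuous_intros continuous_on_bump)
qed

lemma integrable_bump: "r > 0 \<Longrightarrow> integrable lebesgue (bump r c)"
  using integrable_bump_mult[of r "\<lambda>_. 1"] by simp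

text \<open>Translation invariance is used for \<open>lborel\<close>; bumps are Borel functions, so
  passing to the completed measure leaves their integrals unchanged.\<close>

lemma integral_bump_translate: "integral\<^sup>L lebesgue (bump r c) = integral\<^sup>L lebesgue (bump r d)"
proof -
  have m: "bump r e \<in> borel_measurable borel" for e
    by (intro borel_measurable_continuous_onI continuous_on_bump)
  have "integral\<^sup>L lborel (bump r d) = integral\<^sup>L (distr lborel borel ((+) (d - c))) (bump r d)"
    by (simp add: lborel_distr_plus)
  also have "\<dots> = (\<integral>\<xi>. bump r d ((d - c) + \<xi>) \<partial>lborel)"
    using m by (intro integral_distr) auto
  also have "\<dots> = integral\<^sup>L lborel (bump r c)"
    by (intro Bochner_Integration.integral_cong) (auto simp: bump_def algebra_simps)
  finally show ?thesis using m by (simp add: integral_completion)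
qed

lemma integral_bump_pos:
  assumes "r > 0" shows "0 < integral\<^sup>L lebesgue (bump r c)"
proof -
  \<comment> \<open>On the ball of half the radius the positive part is at least r^2 - r^2/4, whence
    the constant 3/4.\<close>
  let ?B = "ball c (r / 2)" and ?m = "(3/4 * r\<^sup>2)\<^sup>2"
  have bd: "?m \<le> bump r c \<xi>" if "\<xi> \<in> ?B" for \<xi>
  proof -
    have "(norm (\<xi> - c))\<^sup>2 \<le> (r/2)\<^sup>2" using that by (intro power_mono) (auto simp: dist_norm norm_minus_commute)
    then have "3/4 * r\<^sup>2 \<le> r\<^sup>2 - (norm (\<xi> - c))\<^sup>2" by (simp add: power2_eq_square)
    then have "3/4 * r\<^sup>2 \<le> max 0 (r\<^sup>2 - (norm (\<xi> - c))\<^sup>2)" by linarith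
    then show ?thesis unfolding bump_def by (intro power_mono) auto
  qed
  have "0 < ?m * measure lebesgue ?B" using assms by (simp add: content_ball_pos)
  also have "\<dots> = (\<integral>\<xi>. ?m * indicator ?B \<xi> \<partial>lebesgue)" by simp
  also have "\<dots> \<le> integral\<^sup>L lebesgue (bump r c)"
    by (rule integral_mono_AE') (use integrable_bump[OF assms] bd in \<open>auto simp: indicator_def\<close>)
  finally show ?thesis .
qed

text \<open>Outside the ball the bump vanishes, and inside it \<open>f\<close> is within \<epsilon>
  of \<open>f c\<close>. Bump averages thus recover the point values of a continuous
  function.\<close>

lemma integral_bump_mult_approx:
  assumes r: "r > 0" and f: "continuous_on UNIV f" and e: "\<And>\<xi>. \<xi> \<in> cball c r \<Longrightarrow> \<bar>f \<xi> - f c\<bar> \<le> \<epsilon>"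
  shows "\<bar>(\<integral>\<xi>. bump r c \<xi> * f \<xi> \<partial>lebesgue) - f c * integral\<^sup>L lebesgue (bump r c)\<bar>
    \<le> \<epsilon> * integral\<^sup>L lebesgue (bump r c)"
proof -
  note int = integrable_bump_mult[OF r f, of c] integrable_bump[OF r, of c]
  have "(\<integral>\<xi>. bump r c \<xi> * f \<xi> \<partial>lebesgue) - f c * integral\<^sup>L lebesgue (bump r c)
      = (\<integral>\<xi>. bump r c \<xi> * f \<xi> - f c * bump r c \<xi> \<partial>lebesgue)" using int by simp
  also have "\<bar>\<dots>\<bar> \<le> (\<integral>\<xi>. \<epsilon> * bump r c \<xi> \<partial>lebesgue)"
    unfolding real_norm_def[symmetric, of "integral\<^sup>L _ _"]
  proof (rule Bochner_Integration.integral_norm_bound_integral)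
    fix \<xi>
    show "norm (bump r c \<xi> * f \<xi> - f c * bump r c \<xi>) \<le> \<epsilon> * bump r c \<xi>"
    proof (cases "\<xi> \<in> cball c r")
      case True
      have "bump r c \<xi> * f \<xi> - f c * bump r c \<xi> = (f \<xi> - f c) * bump r c \<xi>"
        by (simp add: algebra_simps)
      then have "norm (bump r c \<xi> * f \<xi> - f c * bump r c \<xi>) = \<bar>f \<xi> - f c\<bar> * bump r c \<xi>"
        by (simp add: abs_mult)
      then show ?thesis using e[OF True] by (simp add: mult_right_mono)
    qed (simp add: bump_eq_0[OF r])
  qed (use int in auto)
  finally show ?thesis by simp
qed

text \<open>
  Pairing \<open>f\<close> with a bump that moves from \<open>a\<close> to \<open>b\<close> turns the weak gradient into a derivative in
  the time variable.
\<close>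

lemma integral_bump_mult_diff_le:
  fixes f :: "plane \<Rightarrow> real" and g :: "plane \<Rightarrow> real^2"
  assumes f: "continuous_on UNIV f" and g: "has_weak_gradient f g" "g \<in> borel_measurable lebesgue"
    and K: "AE \<xi> in lebesgue. norm (g \<xi>) \<le> K" and r: "r > 0"
  shows "\<bar>(\<integral>\<xi>. bump r b \<xi> * f \<xi> \<partial>lebesgue) - (\<integral>\<xi>. bump r a \<xi> * f \<xi> \<partial>lebesgue)\<bar>
    \<le> K * norm (b - a) * integral\<^sup>L lebesgue (bump r a)"
proof -
  define h where "h = b - a"
  define c where "c t = a + t *\<^sub>R h" for t
  define J where "J = integral\<^sup>L lebesgue (bump r a)"
  \<comment> \<open>\<open>p t\<close> is the time derivative of \<open>bump r (c t)\<close>, that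
    is, minus its directional derivative along \<open>h\<close>.\<close>
  define p where "p t \<xi> = 4 * max 0 (r\<^sup>2 - (norm (\<xi> - c t))\<^sup>2) * ((\<xi> - c t) \<bullet> h)" for t \<xi>
  \<comment> \<open>A single box holds the moving support at all times in [0,1], since the Leibniz
    rule needs a fixed domain of integration.\<close>
  obtain lo hi :: plane where "cball 0 (norm a + norm h + r) \<subseteq> cbox lo hi"
    using bounded_subset_cbox_symmetric[OF bounded_cball] by metis
  moreover have "cball (c t) r \<subseteq> cball 0 (norm a + norm h + r)" if "t \<in> {0..1}" for t
  proof
    fix \<xi> assume "\<xi> \<in> cball (c t) r"
    moreover have "norm (t *\<^sub>R h) \<le> norm h" using that by (simp add: mult_left_le_one_le)
    ultimately show "\<xi> \<in> cball 0 (norm a + norm h + r)"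
      using norm_triangle_ineq[of a "t *\<^sub>R h"] norm_triangle_sub[of \<xi> "c t"]
      by (simp add: c_def dist_norm norm_minus_commute)
  qed
  ultimately have box: "\<xi> \<in> cball (c t) r \<Longrightarrow> \<xi> \<in> cbox lo hi" if "t \<in> {0..1}" for t \<xi> using that by blast
  have z: "bump r (c t) \<xi> = 0" "p t \<xi> = 0" if "t \<in> {0..1}" "\<xi> \<notin> cbox lo hi" for t \<xi>
  proof -
    have "\<xi> \<notin> cball (c t) r" using box that by blast
    then show "bump r (c t) \<xi> = 0" using r bump_eq_0 by blast
    then show "p t \<xi> = 0" by (simp add: bump_def p_def)
  qed
  define F where "F t = integral (cbox lo hi) (\<lambda>\<xi>. bump r (c t) \<xi> * f \<xi>)" for t
  have F: "F t = (\<integral>\<xi>. bump r (c t) \<xi> * f \<xi> \<partial>lebesgue)" if "t \<in> {0..1}" for t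
    unfolding F_def using z[OF that] f
    by (intro integral_compact_support continuous_intros continuous_on_bump) auto
  have cp: "continuous_on UNIV (p t)" for t unfolding p_def by (intro continuous_intros)
  have dF: "(F has_field_derivative integral (cbox lo hi) (\<lambda>\<xi>. p t \<xi> * f \<xi>)) (at t within {0..1})"
    if t: "t \<in> {0..1}" for t
    unfolding F_def
  proof (rule leibniz_rule_field_derivative[where U="{0..1}"])
    fix t \<xi>
    have 1: "((\<lambda>t. \<xi> - t *\<^sub>R h) has_derivative (\<lambda>s. - (s *\<^sub>R h))) (at t within {0..1})"
      by (auto intro!: derivative_eq_intros)
    \<comment> \<open>Moving the centre by \<open>t *\<^sub>R h\<close> amounts to moving the
      argument backwards, so the chain rule applies to a fixed bump.\<close>
    have eq: "bump r (c t) \<xi> = bump r a (\<xi> - t *\<^sub>R h)" for t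
      by (simp add: bump_def c_def algebra_simps)
    have "((\<lambda>t. bump r (c t) \<xi>) has_derivative (\<lambda>s. p t \<xi> * s)) (at t within {0..1})"
      unfolding eq
      by (rule has_derivative_eq_rhs[OF has_derivative_compose[OF 1 has_derivative_bump]])
         (simp add: fun_eq_iff p_def c_def algebra_simps)
    then have "((\<lambda>t. bump r (c t) \<xi>) has_field_derivative p t \<xi>) (at t within {0..1})"
      by (simp add: has_field_derivative_def)
    then show "((\<lambda>t. bump r (c t) \<xi> * f \<xi>) has_field_derivative p t \<xi> * f \<xi>) (at t within {0..1})"
      by (rule DERIV_cmult_right)
  next
    show "(\<lambda>\<xi>. bump r (c t) \<xi> * f \<xi>) integrable_on cbox lo hi" for t
      by (intro integrable_continuous continuous_intros continuous_on_bump continuous_on_subset[OF f]) auto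
    show "continuous_on ({0..1} \<times> cbox lo hi) (\<lambda>(t, \<xi>). p t \<xi> * f \<xi>)"
      unfolding p_def c_def split_beta
      by (intro continuous_intros continuous_on_compose2[OF f]) auto
  qed (use t in auto)
  have bound: "norm (integral (cbox lo hi) (\<lambda>\<xi>. p t \<xi> * f \<xi>)) \<le> K * norm h * J" if t: "t \<in> {0..1}" for t
  proof -
    let ?\<phi> = "bump r (c t)"
    let ?d = "\<lambda>i \<xi>. frechet_derivative ?\<phi> (at \<xi>) (axis i 1)"
    have weak: "(\<integral>\<xi>. ?d i \<xi> * f \<xi> \<partial>lebesgue) = - (\<integral>\<xi>. ?\<phi> \<xi> * g \<xi> $ i \<partial>lebesgue)" for i
      using g(1)[unfolded has_weak_gradient_def lebesgue_on_UNIV_eq, rule_format,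
          OF conjI[OF Ck_on_bump compact_support_bump[OF r]], of "c t" i]
      by simp
    \<comment> \<open>The minus sign here cancels the one from integration by parts in
      \<open>weak\<close>, so that the derivative of \<open>F\<close> becomes the integral of the
      bump times the component of the weak gradient along \<open>h\<close>.\<close>
    have p: "p t \<xi> = - (\<Sum>i\<in>UNIV. h $ i * ?d i \<xi>)" for \<xi>
      unfolding p_def frechet_derivative_bump
      by (simp add: inner_vec_def[of _ h] inner_axis sum_distrib_left sum_distrib_right sum_negf mult_ac)
    have id: "integrable lebesgue (\<lambda>\<xi>. ?d i \<xi> * f \<xi>)" for i
    proof (rule integrable_compact_support[of _ lo hi])
      show "continuous_on UNIV (\<lambda>\<xi>. ?d i \<xi> * f \<xi>)"
        unfolding frechet_derivative_bump by (intro continuous_intros f)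
      show "?d i \<xi> * f \<xi> = 0" if "\<xi> \<notin> cbox lo hi" for \<xi>
        using z(1)[OF t that] by (simp add: frechet_derivative_bump bump_def)
    qed
    have ig: "integrable lebesgue (\<lambda>\<xi>. ?\<phi> \<xi> * g \<xi> $ i)" for i
    proof (rule Bochner_Integration.integrable_bound)
      show "integrable lebesgue (\<lambda>\<xi>. K * ?\<phi> \<xi>)" using integrable_bump[OF r] by auto
      show "(\<lambda>\<xi>. ?\<phi> \<xi> * g \<xi> $ i) \<in> borel_measurable lebesgue"
        using g(2) integrable_bump[OF r, THEN borel_measurable_integrable]
        by (intro borel_measurable_times) (auto simp: cart_eq_inner_axis)
      show "AE \<xi> in lebesgue. norm (?\<phi> \<xi> * g \<xi> $ i) \<le> norm (K * ?\<phi> \<xi>)"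
        using K
      proof (rule AE_mp, intro AE_I2 impI)
        fix \<xi> assume "norm (g \<xi>) \<le> K"
        then have "\<bar>g \<xi> $ i\<bar> \<le> \<bar>K\<bar>" using component_le_norm_cart[of "g \<xi>" i] by linarith
        then show "norm (?\<phi> \<xi> * g \<xi> $ i) \<le> norm (K * ?\<phi> \<xi>)"
          by (simp add: abs_mult mult.commute[of K] mult_left_mono)
      qed
    qed
    have "integral (cbox lo hi) (\<lambda>\<xi>. p t \<xi> * f \<xi>) = (\<integral>\<xi>. p t \<xi> * f \<xi> \<partial>lebesgue)"
      using z[OF t] f cp by (intro integral_compact_support continuous_intros) auto
    also have "\<dots> = (\<integral>\<xi>. - (\<Sum>i\<in>UNIV. h $ i * (?d i \<xi> * f \<xi>)) \<partial>lebesgue)"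
      unfolding p by (simp add: sum_distrib_left sum_distrib_right mult_ac)
    also have "\<dots> = (\<Sum>i\<in>UNIV. h $ i * (\<integral>\<xi>. ?\<phi> \<xi> * g \<xi> $ i \<partial>lebesgue))"
      using id by (simp add: weak sum_negf)
    also have "\<dots> = (\<integral>\<xi>. (\<Sum>i\<in>UNIV. h $ i * (?\<phi> \<xi> * g \<xi> $ i)) \<partial>lebesgue)" using ig by simp
    finally have eq: "integral (cbox lo hi) (\<lambda>\<xi>. p t \<xi> * f \<xi>)
        = (\<integral>\<xi>. (\<Sum>i\<in>UNIV. h $ i * (?\<phi> \<xi> * g \<xi> $ i)) \<partial>lebesgue)" .
    have "norm (integral (cbox lo hi) (\<lambda>\<xi>. p t \<xi> * f \<xi>))
        \<le> (\<integral>\<xi>. norm (\<Sum>i\<in>UNIV. h $ i * (?\<phi> \<xi> * g \<xi> $ i)) \<partial>lebesgue)"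
      unfolding eq by (rule integral_norm_bound)
    also have "\<dots> \<le> (\<integral>\<xi>. K * norm h * ?\<phi> \<xi> \<partial>lebesgue)"
    proof (rule integral_mono_AE)
      show "integrable lebesgue (\<lambda>\<xi>. norm (\<Sum>i\<in>UNIV. h $ i * (?\<phi> \<xi> * g \<xi> $ i)))" using ig by auto
      show "integrable lebesgue (\<lambda>\<xi>. K * norm h * ?\<phi> \<xi>)" using integrable_bump[OF r] by auto
      show "AE \<xi> in lebesgue. norm (\<Sum>i\<in>UNIV. h $ i * (?\<phi> \<xi> * g \<xi> $ i)) \<le> K * norm h * ?\<phi> \<xi>"
        using K
      proof (rule AE_mp, intro AE_I2 impI)
        fix \<xi> assume *: "norm (g \<xi>) \<le> K"
        have "(\<Sum>i\<in>UNIV. h $ i * (?\<phi> \<xi> * g \<xi> $ i)) = ?\<phi> \<xi> * (h \<bullet> g \<xi>)"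
          by (simp add: inner_vec_def sum_distrib_left mult_ac)
        then have "norm (\<Sum>i\<in>UNIV. h $ i * (?\<phi> \<xi> * g \<xi> $ i)) \<le> ?\<phi> \<xi> * (norm h * norm (g \<xi>))"
          using Cauchy_Schwarz_ineq2[of h "g \<xi>"] by (simp add: abs_mult mult_left_mono)
        also have "\<dots> \<le> ?\<phi> \<xi> * (norm h * K)" using * by (intro mult_left_mono) auto
        finally show "norm (\<Sum>i\<in>UNIV. h $ i * (?\<phi> \<xi> * g \<xi> $ i)) \<le> K * norm h * ?\<phi> \<xi>"
          by (simp add: mult_ac)
      qed
    qed
    also have "\<dots> = K * norm h * J"
      by (simp add: J_def integral_bump_translate[of r "c t" a])
    finally show ?thesis .
  qed
  \<comment> \<open>Mean value inequality on the time interval [0,1].\<close>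
  have "norm (F 1 - F 0) \<le> K * norm h * J * norm (1 - 0 :: real)"
    by (rule field_differentiable_bound[OF _ dF bound]) auto
  then show ?thesis by (simp add: F c_def h_def J_def)
qed

text \<open>Averages of \<open>f\<close> over equal bumps at \<open>a\<close> and \<open>b\<close>
  differ by at most \<open>K * norm (b - a)\<close>, and small bumps make these averages approximate
  \<open>f a\<close> and \<open>f b\<close>.\<close>

lemma Lipschitz_if_bounded_weak_gradient:
  fixes f :: "plane \<Rightarrow> real" and g :: "plane \<Rightarrow> real^2"
  assumes f: "continuous_on UNIV f" and g: "has_weak_gradient f g" "g \<in> borel_measurable lebesgue"
    and K: "AE \<xi> in lebesgue. norm (g \<xi>) \<le> K"
  shows "\<bar>f b - f a\<bar> \<le> K * norm (b - a)"
proof (rule field_le_epsilon)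
  fix e :: real assume "e > 0"
  \<comment> \<open>Half of the tolerance goes to each of the two endpoints.\<close>
  define \<epsilon> where "\<epsilon> = e / 2"
  have "\<epsilon> > 0" using \<open>e > 0\<close> by (simp add: \<epsilon>_def)
  have "\<exists>r>0. \<forall>\<xi>\<in>cball c r. \<bar>f \<xi> - f c\<bar> \<le> \<epsilon>" for c
  proof -
    have "isCont f c" using f by (simp add: continuous_on_eq_continuous_at)
    then obtain d where "d > 0" "\<And>\<xi>. dist \<xi> c < d \<Longrightarrow> dist (f \<xi>) (f c) < \<epsilon>"
      using \<open>\<epsilon> > 0\<close> unfolding continuous_at_eps_delta dist_norm by metis
    then show ?thesis by (intro exI[of _ "d/2"]) (auto simp: dist_real_def dist_commute intro: less_imp_le)
  qed
  then obtain r where r: "\<And>c. r c > 0" "\<And>c \<xi>. \<xi> \<in> cball c (r c) \<Longrightarrow> \<bar>f \<xi> - f c\<bar> \<le> \<epsilon>" by metis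
  \<comment> \<open>A common radius gives both bumps the same mass \<open>J\<close>, which can then
    be divided out.\<close>
  define s where "s = min (r a) (r b)"
  have s: "s > 0" using r(1) by (simp add: s_def)
  define J where "J = integral\<^sup>L lebesgue (bump s a)"
  have J: "J > 0" "integral\<^sup>L lebesgue (bump s b) = J"
    using integral_bump_pos[OF s] integral_bump_translate by (auto simp: J_def)
  have "\<bar>(\<integral>\<xi>. bump s a \<xi> * f \<xi> \<partial>lebesgue) - f a * J\<bar> \<le> \<epsilon> * J"
    using integral_bump_mult_approx[OF s f, of a \<epsilon>] r(2)[of _ a] by (simp add: J_def s_def)
  moreover have "\<bar>(\<integral>\<xi>. bump s b \<xi> * f \<xi> \<partial>lebesgue) - f b * J\<bar> \<le> \<epsilon> * J"
    using integral_bump_mult_approx[OF s f, of b \<epsilon>] r(2)[of _ b] unfolding J(2)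
    by (simp add: s_def)
  moreover note integral_bump_mult_diff_le[OF f g K s, of b a, folded J_def]
  ultimately have "\<bar>f b * J - f a * J\<bar> \<le> K * norm (b - a) * J + 2 * (\<epsilon> * J)" by linarith
  then have "\<bar>f b - f a\<bar> * J \<le> (K * norm (b - a) + e) * J"
    using J(1) by (simp add: \<epsilon>_def abs_mult distrib_right flip: left_diff_distrib)
  then show "\<bar>f b - f a\<bar> \<le> K * norm (b - a) + e" using J(1) by simp
qed

lemma AE_norm_le_if_norm_2_inf:
  assumes "norm_2_inf \<Omega> f \<le> ereal K"
  shows "AE \<xi> in lebesgue_on \<Omega>. norm (f \<xi>) \<le> K"
  using esssup_AE[of "\<lambda>\<xi>. ereal (norm (f \<xi>))" "lebesgue_on \<Omega>"]
proof (rule AE_mp, intro AE_I2 impI)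
  fix \<xi> assume "ereal (norm (f \<xi>)) \<le> esssup (lebesgue_on \<Omega>) (\<lambda>\<xi>. ereal (norm (f \<xi>)))"
  with assms have "ereal (norm (f \<xi>)) \<le> ereal K" unfolding norm_2_inf_def by (rule order_trans[rotated])
  then show "norm (f \<xi>) \<le> K" by simp
qed

lemma ereal_le_sqrt_if_power2_le:
  assumes "e\<^sup>2 \<le> ereal M" shows "e \<le> ereal (sqrt M)"
  using assms by (cases e) (auto simp: power2_eq_square intro: real_le_rsqrt)

text \<open>The comparison set bounds the square of the essential supremum, hence the constant
  \<open>sqrt M\<close>. Continuity selects the representative for which the estimate holds at every
  pair of points.\<close>

lemma comparison_Lipschitz:
  fixes f :: "plane \<Rightarrow> real"
  assumes "continuous_on UNIV f" "H1_gradient f g" "(norm_2_inf UNIV g)\<^sup>2 \<le> ereal M"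
  shows "\<bar>f b - f a\<bar> \<le> sqrt M * norm (b - a)"
  using assms AE_norm_le_if_norm_2_inf[OF ereal_le_sqrt_if_power2_le[OF assms(3)], unfolded lebesgue_on_UNIV_eq]
  by (intro Lipschitz_if_bounded_weak_gradient)
     (auto simp: H1_gradient_def L2_def lebesgue_on_UNIV_eq)

section \<open>The proximal steps\<close>

context
  fixes \<Omega> :: "plane set" and X :: "(plane \<Rightarrow> 'b::euclidean_space) set"
  assumes X: "fin_dim_L2_subspace \<Omega> X"
begin

lemma fin_dim_L2: "f \<in> X \<Longrightarrow> f \<in> L2 \<Omega>"
  using X by (auto simp: fin_dim_L2_subspace_def)

lemma fin_dim_L2_linear_combination:
  assumes "f \<in> X" "g \<in> X"
  shows "(\<lambda>\<xi>. s *\<^sub>R f \<xi> + t *\<^sub>R g \<xi>) \<in> X"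
proof -
  obtain B where B: "X = {f \<in> L2 \<Omega>. \<exists>c. ae_eq \<Omega> f (\<lambda>\<xi>. \<Sum>b\<in>B. c b *\<^sub>R b \<xi>)}"
    using X unfolding fin_dim_L2_subspace_def by blast
  obtain c d where cd: "ae_eq \<Omega> f (\<lambda>\<xi>. \<Sum>b\<in>B. c b *\<^sub>R b \<xi>)" "ae_eq \<Omega> g (\<lambda>\<xi>. \<Sum>b\<in>B. d b *\<^sub>R b \<xi>)"
    using assms unfolding B by blast
  have "ae_eq \<Omega> (\<lambda>\<xi>. s *\<^sub>R f \<xi> + t *\<^sub>R g \<xi>) (\<lambda>\<xi>. \<Sum>b\<in>B. (s * c b + t * d b) *\<^sub>R b \<xi>)"
    using cd unfolding ae_eq_def
    by eventually_elim (simp add: scaleR_sum_right scaleR_add_left sum.distrib)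
  moreover have "(\<lambda>\<xi>. s *\<^sub>R f \<xi> + t *\<^sub>R g \<xi>) \<in> L2 \<Omega>"
    using assms fin_dim_L2 by (intro L2_add L2_scaleR) auto
  ultimately show ?thesis
    unfolding B by (intro CollectI conjI exI[of _ "\<lambda>b. s * c b + t * d b"])
qed

lemma fin_dim_L2_zero: "(\<lambda>_. 0) \<in> X"
proof -
  obtain B where B: "X = {f \<in> L2 \<Omega>. \<exists>c. ae_eq \<Omega> f (\<lambda>\<xi>. \<Sum>b\<in>B. c b *\<^sub>R b \<xi>)}"
    using X unfolding fin_dim_L2_subspace_def by blast
  show ?thesis unfolding B by (auto simp: L2_def ae_eq_def intro!: exI[of _ "\<lambda>_. 0"])
qed

end

text \<open>With \<open>y\<close> in \<open>Y\<close>, the squared norm of \<open>Dadj y\<close> is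
  the inner product of \<open>D (Dadj y)\<close> and \<open>y\<close>; bound it by Cauchy-Schwarz
  and cancel one factor. The absolute value covers a negative bound \<open>C\<close> for
  \<open>D\<close>, possible when all norms in \<open>X\<close> vanish.\<close>

lemma adjoint_op_bounded:
  fixes X :: "(plane \<Rightarrow> 'a::euclidean_space) set" and Y :: "(plane \<Rightarrow> 'b::euclidean_space) set"
  assumes X: "fin_dim_L2_subspace \<Omega> X" and Y: "fin_dim_L2_subspace \<Omega> Y"
    and D: "bounded_linear_op \<Omega> X Y D" "adjoint_op \<Omega> X Y D Dadj"
  obtains C where "C \<ge> 0" "\<And>y. y \<in> Y \<Longrightarrow> L2_norm \<Omega> (Dadj y) \<le> C * L2_norm \<Omega> y"
proof -
  obtain C where C: "\<And>f. f \<in> X \<Longrightarrow> L2_norm \<Omega> (D f) \<le> C * L2_norm \<Omega> f"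
    using D(1) unfolding bounded_linear_op_def by blast
  have "L2_norm \<Omega> (Dadj y) \<le> \<bar>C\<bar> * L2_norm \<Omega> y" if y: "y \<in> Y" for y
  proof -
    let ?n = "L2_norm \<Omega> (Dadj y)"
    have x: "Dadj y \<in> X" "D (Dadj y) \<in> Y"
      using D y unfolding adjoint_op_def bounded_linear_op_def by blast+
    have "?n\<^sup>2 = L2_inner \<Omega> (Dadj y) (Dadj y)"
      by (simp add: L2_norm_power2 L2_inner_def power2_norm_eq_inner)
    also have "\<dots> = L2_inner \<Omega> (D (Dadj y)) y" using D(2) x y unfolding adjoint_op_def by metis
    also have "\<dots> \<le> L2_norm \<Omega> (D (Dadj y)) * L2_norm \<Omega> y"
      using fin_dim_L2[OF Y] x y by (intro L2_inner_le) auto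
    also have "\<dots> \<le> (\<bar>C\<bar> * ?n) * L2_norm \<Omega> y"
      using C[OF x(1)] mult_right_mono[OF abs_ge_self[of C] L2_norm_nonneg[of \<Omega> "Dadj y"]]
      by (intro mult_right_mono) auto
    finally have "?n * ?n \<le> (\<bar>C\<bar> * L2_norm \<Omega> y) * ?n" by (simp add: power2_eq_square mult_ac)
    then show ?thesis
      by (cases "?n = 0") (auto simp: less_le dest: mult_right_le_imp_le)
  qed
  then show ?thesis using that[of "\<bar>C\<bar>"] by auto
qed

text \<open>On a set of finite measure a pointwise bound by 1 is an L^2 bound, by comparison with
  the constant 1. This makes the dual variables of order \<alpha>.\<close>

lemma L2_norm_scaled_dual_ball_le:
  assumes \<Omega>: "\<Omega> \<in> lmeasurable" and y: "y \<in> dual_ball \<Omega> Y"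
  shows "L2_norm \<Omega> (\<lambda>\<xi>. a *\<^sub>R y \<xi>) \<le> \<bar>a\<bar> * sqrt (measure lebesgue \<Omega>)"
proof -
  have one: "(\<lambda>_. 1::real) \<in> L2 \<Omega>"
    using finite_measure_lebesgue_on[OF \<Omega>] by (simp add: L2_def finite_measure.integrable_const)
  have "L2_norm \<Omega> y \<le> L2_norm \<Omega> (\<lambda>_. 1::real)"
    using y AE_norm_le_if_norm_2_inf[of \<Omega> y 1] one
    by (intro L2_norm_mono) (auto simp: dual_ball_def one_ereal_def)
  also have "\<dots> = sqrt (measure lebesgue \<Omega>)"
    using \<Omega> by (simp add: L2_norm_def measure_restrict_space fmeasurableD)
  finally show ?thesis by (simp add: L2_norm_scaleR mult_left_mono)
qed

text \<open>Outside the scaled ball the objective is infinite, whereas at 0, a member of the ball,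
  it is finite; a minimiser cannot lie outside.\<close>

lemma prox_Gconj_pred_in_scaled_dual_ball:
  assumes Y: "fin_dim_L2_subspace \<Omega> Y" and s: "s > 0"
    and p: "is_prox \<Omega> Y (\<lambda>z. ereal s * Gconj_pred \<Omega> Y a r z) w p"
  shows "p \<in> (\<lambda>y \<xi>. a *\<^sub>R y \<xi>) ` dual_ball \<Omega> Y"
proof (rule ccontr)
  assume *: "p \<notin> (\<lambda>y \<xi>. a *\<^sub>R y \<xi>) ` dual_ball \<Omega> Y"
  let ?F = "\<lambda>z. ereal s * Gconj_pred \<Omega> Y a r z + ereal (1/2 * (L2_norm \<Omega> (\<lambda>\<xi>. z \<xi> - w \<xi>))\<^sup>2)"
  have "?F p = \<infinity>" using * s by (simp add: Gconj_pred_def Gconj_def indicator_fun_def)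
  have "(\<lambda>_. 0) \<in> dual_ball \<Omega> Y"
    using fin_dim_L2_zero[OF Y] by (auto simp: dual_ball_def norm_2_inf_def intro!: esssup_I)
  then have "(\<lambda>_. 0) \<in> (\<lambda>y \<xi>. a *\<^sub>R y \<xi>) ` dual_ball \<Omega> Y" by (rule rev_image_eqI) simp
  then have "?F (\<lambda>_. 0) < \<infinity>" by (simp add: Gconj_pred_def Gconj_def indicator_fun_def)
  then have "?F (\<lambda>_. 0) < ?F p" unfolding \<open>?F p = \<infinity>\<close> .
  then show False
    using p fin_dim_L2_zero[OF Y] unfolding is_prox_def is_arg_min_def by blast
qed

text \<open>Completing the square: up to a constant the objective is \<open>(1 + \<tau>) / 2\<close>
  times the squared distance to the weighted mean \<open>m\<close>, which itself lies in
  \<open>X\<close>. Minimisers are determined only up to null sets, so the conclusion is a vanishing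
  norm.\<close>

lemma prox_Ffun:
  assumes X: "fin_dim_L2_subspace \<Omega> X" and \<tau>: "\<tau> > 0" and w: "w \<in> X" and b: "b \<in> X"
    and p: "is_prox \<Omega> X (\<lambda>z. ereal \<tau> * Ffun \<Omega> b z) w p"
  shows "p \<in> X" "L2_norm \<Omega> (\<lambda>\<xi>. p \<xi> - (w \<xi> + \<tau> * b \<xi>) / (1 + \<tau>)) = 0"
proof -
  define m where "m \<xi> = (w \<xi> + \<tau> * b \<xi>) / (1 + \<tau>)" for \<xi>
  have m: "m \<in> X"
    using fin_dim_L2_linear_combination[OF X w b, of "1 / (1 + \<tau>)" "\<tau> / (1 + \<tau>)"]
    by (simp add: m_def[abs_def] add_divide_distrib)
  let ?n = "\<lambda>f. (L2_norm \<Omega> f)\<^sup>2"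
  have key: "\<tau> * ?n (\<lambda>\<xi>. b \<xi> - z \<xi>) + ?n (\<lambda>\<xi>. z \<xi> - w \<xi>)
      = (1 + \<tau>) * ?n (\<lambda>\<xi>. z \<xi> - m \<xi>) + \<tau> / (1 + \<tau>) * ?n (\<lambda>\<xi>. b \<xi> - w \<xi>)" if z: "z \<in> X" for z
  proof -
    have pt: "\<tau> * (b \<xi> - z \<xi>)\<^sup>2 + (z \<xi> - w \<xi>)\<^sup>2
        = (1 + \<tau>) * (z \<xi> - m \<xi>)\<^sup>2 + \<tau> / (1 + \<tau>) * (b \<xi> - w \<xi>)\<^sup>2" for \<xi>
    proof -
      \<comment> \<open>Eliminating \<open>w\<close> in favour of \<open>m\<close> removes the
        division and turns the identity into a polynomial one.\<close>
      have "w \<xi> = (1 + \<tau>) * m \<xi> - \<tau> * b \<xi>" using \<tau> by (simp add: m_def)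
      then have w: "b \<xi> - w \<xi> = (1 + \<tau>) * (b \<xi> - m \<xi>)"
        "z \<xi> - w \<xi> = (z \<xi> - m \<xi>) + \<tau> * (b \<xi> - m \<xi>)" by (auto simp: algebra_simps)
      have "\<tau> / (1 + \<tau>) * (b \<xi> - w \<xi>)\<^sup>2 = \<tau> * (1 + \<tau>) * (b \<xi> - m \<xi>)\<^sup>2"
        unfolding w using \<tau> by (simp add: power_mult_distrib power2_eq_square)
      then show ?thesis unfolding w(2) by (simp add: power2_eq_square algebra_simps)
    qed
    note ints = L2_D(2)[OF L2_diff[OF fin_dim_L2[OF X] fin_dim_L2[OF X]], simplified]
    have "\<tau> * ?n (\<lambda>\<xi>. b \<xi> - z \<xi>) + ?n (\<lambda>\<xi>. z \<xi> - w \<xi>)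
        = (\<integral>\<xi>. \<tau> * (b \<xi> - z \<xi>)\<^sup>2 + (z \<xi> - w \<xi>)\<^sup>2 \<partial>lebesgue_on \<Omega>)"
      using ints[OF b z] ints[OF z w] by (simp add: L2_norm_power2)
    also have "\<dots> = (1 + \<tau>) * ?n (\<lambda>\<xi>. z \<xi> - m \<xi>) + \<tau> / (1 + \<tau>) * ?n (\<lambda>\<xi>. b \<xi> - w \<xi>)"
      unfolding pt using ints[OF z m] ints[OF b w] by (simp add: L2_norm_power2)
    finally show ?thesis .
  qed
  show pX: "p \<in> X" using p unfolding is_prox_def is_arg_min_def by blast
  have "\<not> ereal \<tau> * Ffun \<Omega> b m + ereal (1/2 * ?n (\<lambda>\<xi>. m \<xi> - w \<xi>))
      < ereal \<tau> * Ffun \<Omega> b p + ereal (1/2 * ?n (\<lambda>\<xi>. p \<xi> - w \<xi>))"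
    using p m unfolding is_prox_def is_arg_min_def by blast
  then have "\<tau> * ?n (\<lambda>\<xi>. b \<xi> - p \<xi>) + ?n (\<lambda>\<xi>. p \<xi> - w \<xi>)
      \<le> \<tau> * ?n (\<lambda>\<xi>. b \<xi> - m \<xi>) + ?n (\<lambda>\<xi>. m \<xi> - w \<xi>)"
    by (simp add: Ffun_def)
  then have "(1 + \<tau>) * ?n (\<lambda>\<xi>. p \<xi> - m \<xi>) \<le> (1 + \<tau>) * ?n (\<lambda>\<xi>. m \<xi> - m \<xi>)"
    unfolding key[OF pX] key[OF m] by simp
  moreover have "L2_norm \<Omega> (\<lambda>\<xi>. m \<xi> - m \<xi>) = 0" by (simp add: L2_norm_def)
  ultimately show "L2_norm \<Omega> (\<lambda>\<xi>. p \<xi> - (w \<xi> + \<tau> * b \<xi>) / (1 + \<tau>)) = 0"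
    using \<tau> L2_norm_nonneg[of \<Omega> "\<lambda>\<xi>. p \<xi> - m \<xi>"]
    by (simp add: mult_le_0_iff flip: m_def del: L2_norm_nonneg)
qed

text \<open>The minimiser is a mean of \<open>w - \<tau> d\<close> and \<open>b\<close> with weights
  summing to 1, so \<open>z\<close> can be subtracted inside the mean. In the application
  \<open>d\<close> is the adjoint applied to the predicted dual variable and \<open>z\<close> is the
  true image; the division by \<open>1 + \<tau>\<close> supplies the contraction.\<close>

lemma prox_Ffun_error:
  assumes X: "fin_dim_L2_subspace \<Omega> X" and \<tau>: "\<tau> > 0"
    and m: "w \<in> X" "d \<in> X" "b \<in> X" "z \<in> X"
    and p: "is_prox \<Omega> X (\<lambda>z. ereal \<tau> * Ffun \<Omega> b z) (\<lambda>\<xi>. w \<xi> - \<tau> * d \<xi>) p"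
  shows "L2_norm \<Omega> (\<lambda>\<xi>. p \<xi> - z \<xi>)
    \<le> (L2_norm \<Omega> (\<lambda>\<xi>. w \<xi> - z \<xi>) + \<tau> * L2_norm \<Omega> (\<lambda>\<xi>. b \<xi> - z \<xi>) + \<tau> * L2_norm \<Omega> d) / (1 + \<tau>)"
proof -
  note L2 = fin_dim_L2[OF X]
  define c where "c = 1 / (1 + \<tau>)"
  have c: "c > 0" using \<tau> by (simp add: c_def)
  have w': "(\<lambda>\<xi>. w \<xi> - \<tau> * d \<xi>) \<in> X"
    using fin_dim_L2_linear_combination[OF X m(1,2), of 1 "- \<tau>"] by simp
  define q where "q \<xi> = c *\<^sub>R (w \<xi> - \<tau> * d \<xi>) + (c * \<tau>) *\<^sub>R b \<xi>" for \<xi>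
  have q: "q \<in> X" unfolding q_def[abs_def] by (rule fin_dim_L2_linear_combination[OF X w' m(3)])
  have q_eq: "q \<xi> = (w \<xi> - \<tau> * d \<xi> + \<tau> * b \<xi>) / (1 + \<tau>)" for \<xi>
    by (simp add: q_def c_def add_divide_distrib)
  note pq = prox_Ffun[OF X \<tau> w' m(3) p, folded q_eq]
  have s1: "(\<lambda>\<xi>. w \<xi> - z \<xi>) \<in> L2 \<Omega>" and s2: "(\<lambda>\<xi>. \<tau> *\<^sub>R (b \<xi> - z \<xi>)) \<in> L2 \<Omega>"
    and s3: "(\<lambda>\<xi>. \<tau> *\<^sub>R d \<xi>) \<in> L2 \<Omega>"
    using m L2 by (auto intro!: L2_diff L2_scaleR simp del: real_scaleR_def)
  have "q \<xi> - z \<xi> = c *\<^sub>R (((w \<xi> - z \<xi>) + \<tau> *\<^sub>R (b \<xi> - z \<xi>)) - \<tau> *\<^sub>R d \<xi>)" for \<xi>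
    using \<tau> unfolding q_eq c_def by (simp add: field_simps)
  then have "L2_norm \<Omega> (\<lambda>\<xi>. q \<xi> - z \<xi>)
      = c * L2_norm \<Omega> (\<lambda>\<xi>. ((w \<xi> - z \<xi>) + \<tau> *\<^sub>R (b \<xi> - z \<xi>)) - \<tau> *\<^sub>R d \<xi>)"
    using c by (simp only: L2_norm_scaleR abs_of_pos)
  also have "\<dots> \<le> c * (L2_norm \<Omega> (\<lambda>\<xi>. w \<xi> - z \<xi>) + \<tau> * L2_norm \<Omega> (\<lambda>\<xi>. b \<xi> - z \<xi>) + \<tau> * L2_norm \<Omega> d)"
    using L2_norm_triangle_diff[OF L2_add[OF s1 s2] s3] L2_norm_triangle[OF s1 s2] \<tau> c
    unfolding L2_norm_scaleR by (intro mult_left_mono) auto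
  finally show ?thesis
    using L2_norm_diff_triangle[OF L2[OF pq(1)] L2[OF q] L2[OF m(4)]] pq(2) by (simp add: c_def)
qed

section \<open>Propagation of the error\<close>

text \<open>The intermediate term is \<open>fbar \<circ> v\<close>: the bijection \<open>v\<close>
  allows a change of variables for \<open>f - fbar\<close>, and the Lipschitz bound of
  \<open>fbar\<close> absorbs the change from \<open>v\<close> to \<open>vbar\<close>. Neither
  bijectivity of \<open>vbar\<close> nor regularity of \<open>f\<close> enters.\<close>

lemma transport_error:
  fixes f fbar z :: "plane \<Rightarrow> real"
  assumes S: "\<Omega> \<in> sets lebesgue" and v: "bij_betw v \<Omega> \<Omega>"
    and d: "\<And>\<xi>. \<xi> \<in> \<Omega> \<Longrightarrow> inv_into \<Omega> v differentiable (at \<xi>)"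
    and L: "\<And>\<xi>. \<xi> \<in> \<Omega> \<Longrightarrow> \<bar>det (jacobian (inv_into \<Omega> v) (at \<xi>))\<bar> \<le> L"
    and f: "f \<in> L2 \<Omega>" "f \<circ> v \<in> L2 \<Omega>" "fbar \<in> L2 \<Omega>" "fbar \<circ> v \<in> L2 \<Omega>"
    and z: "z \<in> L2 \<Omega>" "ae_eq \<Omega> z (fbar \<circ> vbar)"
    and vs: "v \<in> L2 \<Omega>" "vbar \<in> L2 \<Omega>"
    and lip: "\<And>a b. \<bar>fbar a - fbar b\<bar> \<le> K * norm (a - b)"
  shows "L2_norm \<Omega> (\<lambda>\<xi>. f (v \<xi>) - z \<xi>)
    \<le> sqrt L * L2_norm \<Omega> (\<lambda>\<xi>. f \<xi> - fbar \<xi>) + K * L2_norm \<Omega> (\<lambda>\<xi>. v \<xi> - vbar \<xi>)"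
proof -
  \<comment> \<open>The Lipschitz bound at two points of distance 1 forces this.\<close>
  have K: "K \<ge> 0"
    using order_trans[OF abs_ge_zero lip[of 0 "axis 1 1"]] by (simp add: norm_axis_1)
  have "L2_norm \<Omega> (\<lambda>\<xi>. f (v \<xi>) - fbar (v \<xi>)) \<le> sqrt L * L2_norm \<Omega> (\<lambda>\<xi>. f \<xi> - fbar \<xi>)"
    using L2_norm_comp_le[OF S v d L L2_diff[OF f(1,3)]] L2_diff[OF f(2,4)] by (simp add: o_def)
  moreover have "L2_norm \<Omega> (\<lambda>\<xi>. fbar (v \<xi>) - z \<xi>) \<le> L2_norm \<Omega> (\<lambda>\<xi>. K *\<^sub>R (v \<xi> - vbar \<xi>))"
  proof (rule L2_norm_mono)
    show "AE \<xi> in lebesgue_on \<Omega>. norm (fbar (v \<xi>) - z \<xi>) \<le> norm (K *\<^sub>R (v \<xi> - vbar \<xi>))"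
      using z(2) unfolding ae_eq_def by eventually_elim (use K lip in simp)
  qed (use vs in \<open>auto intro: L2_scaleR L2_diff\<close>)
  ultimately show ?thesis
    using L2_norm_diff_triangle[OF f(2,4) z(1)] K by (simp add: L2_norm_scaleR)
qed

section \<open>Scalar recursions, means of squares and limits of suprema\<close>

lemma affine_contraction_bound:
  fixes e :: "nat \<Rightarrow> real"
  assumes q: "0 \<le> q" "q < 1" and s: "0 \<le> s" and e: "\<And>k. e (Suc k) \<le> q * e k + s"
  shows "e k \<le> e 0 * q ^ k + s / (1 - q)"
proof (induction k)
  case 0
  then show ?case using q s by simp
next
  case (Suc k)
  \<comment> \<open>\<open>s / (1 - q)\<close> is the fixed point of the map sending t to q t + s,
    so the bound reproduces itself.\<close>
  have "e (Suc k) \<le> q * (e 0 * q ^ k + s / (1 - q)) + s"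
    using e[of k] mult_left_mono[OF Suc q(1)] by linarith
  also have "\<dots> = e 0 * q ^ Suc k + s / (1 - q)" using q by (simp add: field_simps)
  finally show ?case .
qed

text \<open>The transient part is summable with a sum independent of \<open>N\<close>, so its mean
  decays like \<open>1 / N\<close>; only the constant part survives.\<close>

lemma mean_square_geometric_bound:
  fixes d :: "nat \<Rightarrow> real"
  assumes q: "0 \<le> q" "q < 1" and d: "\<And>k. 0 \<le> d k" "\<And>k. d k \<le> A * q ^ k + B" and N: "N > 0"
  shows "1 / real N * (\<Sum>k<N. (d k)\<^sup>2) \<le> 2 * A\<^sup>2 / (1 - q) / real N + 2 * B\<^sup>2"
proof -
  have "(d k)\<^sup>2 \<le> 2 * A\<^sup>2 * q ^ k + 2 * B\<^sup>2" for k
  proof -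
    have "(d k)\<^sup>2 \<le> (A * q ^ k + B)\<^sup>2" using d by (intro power_mono) auto
    also have "\<dots> \<le> 2 * (A * q ^ k)\<^sup>2 + 2 * B\<^sup>2"
      using sum_squares_bound[of "A * q ^ k" B] by (simp add: power2_sum)
    \<comment> \<open>One factor \<open>q ^ k\<close> is dropped to reach a geometric series with
      ratio \<open>q\<close>.\<close>
    also have "(A * q ^ k)\<^sup>2 = A\<^sup>2 * (q ^ k * q ^ k)" by (simp add: power2_eq_square)
    also have "\<dots> \<le> A\<^sup>2 * q ^ k"
      using q power_le_one[of q k] by (intro mult_left_mono mult_left_le) auto
    finally show ?thesis by simp
  qed
  then have "(\<Sum>k<N. (d k)\<^sup>2) \<le> (\<Sum>k<N. 2 * A\<^sup>2 * q ^ k + 2 * B\<^sup>2)" by (rule sum_mono)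
  also have "\<dots> = 2 * A\<^sup>2 * (\<Sum>k<N. q ^ k) + real N * (2 * B\<^sup>2)"
    by (simp add: sum.distrib sum_distrib_left)
  also have "(\<Sum>k<N. q ^ k) \<le> 1 / (1 - q)"
    using q by (simp add: sum_gp_strict divide_right_mono)
  finally have "(\<Sum>k<N. (d k)\<^sup>2) \<le> 2 * A\<^sup>2 * (1 / (1 - q)) + real N * (2 * B\<^sup>2)"
    by (simp add: mult_left_mono)
  then have "(\<Sum>k<N. (d k)\<^sup>2) / real N \<le> (2 * A\<^sup>2 * (1 / (1 - q)) + real N * (2 * B\<^sup>2)) / real N"
    by (rule divide_right_mono) simp
  then show ?thesis using N by (simp add: add_divide_distrib)
qed

lemma SUP_tendsto_0:
  fixes \<Phi> :: "'a \<Rightarrow> nat \<Rightarrow> real"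
  assumes nn: "\<And>\<delta> N. 0 \<le> \<Phi> \<delta> N"
    and le: "\<And>\<epsilon>. \<epsilon> > 0 \<Longrightarrow> \<forall>\<^sub>F \<delta> in F. \<forall>N\<ge>Nbar \<delta>. \<Phi> \<delta> N \<le> \<epsilon>"
  shows "((\<lambda>\<delta>. SUP N\<in>{Nbar \<delta>..}. ereal (\<Phi> \<delta> N)) \<longlongrightarrow> 0) F"
proof (rule order_tendstoI)
  fix a :: ereal assume "a < 0"
  have "0 \<le> (SUP N\<in>{Nbar \<delta>..}. ereal (\<Phi> \<delta> N))" for \<delta>
    by (rule SUP_upper2[of "Nbar \<delta>"]) (auto simp: nn)
  then show "\<forall>\<^sub>F \<delta> in F. a < (SUP N\<in>{Nbar \<delta>..}. ereal (\<Phi> \<delta> N))"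
    using \<open>a < 0\<close> by (intro always_eventually allI) (rule less_le_trans)
next
  fix a :: ereal assume "0 < a"
  \<comment> \<open>A supremum need not preserve strict bounds, so a real number is placed strictly
    below \<open>a\<close>.\<close>
  then obtain \<epsilon> where \<epsilon>: "0 < ereal \<epsilon>" "ereal \<epsilon> < a" using ereal_dense2 by blast
  then have "\<forall>\<^sub>F \<delta> in F. \<forall>N\<ge>Nbar \<delta>. \<Phi> \<delta> N \<le> \<epsilon>" by (intro le) simp
  then show "\<forall>\<^sub>F \<delta> in F. (SUP N\<in>{Nbar \<delta>..}. ereal (\<Phi> \<delta> N)) < a"
    by eventually_elim (rule le_less_trans[OF SUP_least \<epsilon>(2)], auto)
qed

theorem theorem5p3:
  fixes \<Omega> :: "plane set"
    and X :: "(plane \<Rightarrow> real) set" and Y V VV :: "(plane \<Rightarrow> plane) set"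
    and D :: "(plane \<Rightarrow> real) \<Rightarrow> (plane \<Rightarrow> plane)"
    and Dadj :: "(plane \<Rightarrow> plane) \<Rightarrow> (plane \<Rightarrow> real)"
    and U0 :: "((plane \<Rightarrow> real) \<times> (plane \<Rightarrow> plane)) set"
    and M \<tau> \<sigma> \<sigma>t \<rho>t \<Lambda> \<kappa> :: real
    and \<alpha> :: "real \<Rightarrow> real"
    and b :: "real \<Rightarrow> nat \<Rightarrow> plane \<Rightarrow> real" and bbar :: "nat \<Rightarrow> plane \<Rightarrow> real"
    and v :: "real \<Rightarrow> nat \<Rightarrow> plane \<Rightarrow> plane" and vbar :: "nat \<Rightarrow> plane \<Rightarrow> plane"
    and x0 :: "plane \<Rightarrow> real" and y0 :: "plane \<Rightarrow> plane"
    and x :: "real \<Rightarrow> nat \<Rightarrow> plane \<Rightarrow> real" and y :: "real \<Rightarrow> nat \<Rightarrow> plane \<Rightarrow> plane"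
  assumes domain: "open \<Omega>" "connected \<Omega>" "\<Omega> \<noteq> {}"
    and spaces: "fin_dim_L2_subspace \<Omega> X" "fin_dim_L2_subspace \<Omega> Y" "displacement_space \<Omega> V"
    and operator: "bounded_linear_op \<Omega> X Y D" "adjoint_op \<Omega> X Y D Dadj"
    and true_data: "\<And>k. bbar k \<in> X" "\<And>k. vbar k \<in> V" "\<And>k. vbar k \<in> H1"
    and measured_images: "\<And>\<delta> k. \<delta> > 0 \<Longrightarrow> b \<delta> k \<in> X"
    and fields: "VV \<subseteq> V" "\<And>w. w \<in> VV \<Longrightarrow> bij_betw w \<Omega> \<Omega>"
      "\<And>w \<xi>. w \<in> VV \<Longrightarrow> \<xi> \<in> \<Omega> \<Longrightarrow> inv_into \<Omega> w differentiable (at \<xi>)"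
      "Lambda_sup \<Omega> VV < 2"
    and measured_fields: "\<And>\<delta> k. \<delta> > 0 \<Longrightarrow> v \<delta> k \<in> VV"
      "\<And>\<delta> k f. \<delta> > 0 \<Longrightarrow> f \<in> X \<Longrightarrow> f \<circ> v \<delta> k \<in> X"
      "\<And>\<delta> k f. \<delta> > 0 \<Longrightarrow> f \<in> Y \<Longrightarrow> f \<circ> v \<delta> k \<in> Y"
    and comparison: "M > 0" "U0 \<subseteq> X \<times> Y"
      "\<exists>C. \<forall>(p, q)\<in>U0. (L2_norm \<Omega> p)\<^sup>2 + (L2_norm \<Omega> q)\<^sup>2 \<le> C"
    and alpha: "\<And>\<delta>. \<delta> > 0 \<Longrightarrow> \<alpha> \<delta> > 0" "(\<alpha> \<longlongrightarrow> 0) (at_right 0)"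
    and truth: "\<And>\<delta>. \<delta> > 0 \<Longrightarrow>
      bbar \<in> image_comparison_set \<Omega> X Y D M U0 vbar \<sigma>t \<rho>t (\<alpha> \<delta>)"
    and noise:
      "((\<lambda>\<delta>. SUP k. ereal (L2_norm \<Omega> (\<lambda>\<xi>. b \<delta> k \<xi> - bbar k \<xi>))) \<longlongrightarrow> 0) (at_right 0)"
      "((\<lambda>\<delta>. SUP k. ereal (L2_norm \<Omega> (\<lambda>\<xi>. v \<delta> k \<xi> - vbar k \<xi>))) \<longlongrightarrow> 0) (at_right 0)"
    and steps: "ereal \<Lambda> > Lambda_sup \<Omega> VV" "0 < \<kappa>" "\<kappa> < 1" "\<tau> > 0" "\<sigma> > 0"
      "\<sigma>t = \<Lambda> * \<sigma> / \<kappa>"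
      "\<rho>t \<ge> 1 / (2 * \<sigma>) * (1 - \<kappa> / \<Lambda>)"
      "1 + \<tau> \<ge> \<Lambda> + \<tau> * \<sigma> * (op_norm \<Omega> X D)\<^sup>2 / (1 - \<kappa>)"
      "1 \<ge> \<tau> * \<sigma> * (op_norm \<Omega> X D)\<^sup>2"
    and initial: "x0 \<in> X" "y0 \<in> Y" "\<And>\<delta>. \<delta> > 0 \<Longrightarrow> x \<delta> 0 = x0" "\<And>\<delta>. \<delta> > 0 \<Longrightarrow> y \<delta> 0 = y0"
    and algorithm: "\<And>\<delta>. \<delta> > 0 \<Longrightarrow>
      POPD \<Omega> X Y D Dadj \<tau> \<sigma> \<sigma>t \<rho>t (\<alpha> \<delta>) (b \<delta>) (v \<delta>) (x \<delta>) (y \<delta>)"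
  shows "\<exists>Nbar :: real \<Rightarrow> nat.
     ((\<lambda>\<delta>. SUP N\<in>{Nbar \<delta>..}.
         ereal (1 / real N * (\<Sum>k = 1..N. (L2_norm \<Omega> (\<lambda>\<xi>. x \<delta> k \<xi> - bbar k \<xi>))\<^sup>2)))
       \<longlongrightarrow> 0) (at_right 0) \<and>
     (\<tau> * \<sigma> * (op_norm \<Omega> X D)\<^sup>2 < 1 \<longrightarrow>
       ((\<lambda>\<delta>. SUP N\<in>{Nbar \<delta>..}.
           ereal (1 / (2 * real N) *
             (\<Sum>k<N. (L2_norm \<Omega> (\<lambda>\<xi>. x \<delta> (Suc k) \<xi> - x \<delta> k (v \<delta> k \<xi>)))\<^sup>2)))
         \<longlongrightarrow> 0) (at_right 0))"
proof -
  have S: "\<Omega> \<in> sets lebesgue" using domain(1) by simp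
  have VL2: "w \<in> L2 \<Omega>" if "w \<in> V" for w using spaces(3) that by (auto simp: displacement_space_def)
  have detL: "\<bar>det (jacobian (inv_into \<Omega> w) (at \<xi>))\<bar> \<le> \<Lambda>" if "w \<in> VV" "\<xi> \<in> \<Omega>" for w \<xi>
  proof -
    have "ereal \<bar>det (jacobian (inv_into \<Omega> w) (at \<xi>))\<bar> \<le> Lambda_sup \<Omega> VV"
      unfolding Lambda_sup_def by (rule SUP_upper2[OF that(1)], rule SUP_upper[OF that(2)])
    then have "ereal \<bar>det (jacobian (inv_into \<Omega> w) (at \<xi>))\<bar> < ereal \<Lambda>"
      using steps(1) by (rule le_less_trans)
    then show ?thesis by simp
  qed
  \<comment> \<open>Noise level 1 and frame 0 are arbitrary: some member of \<open>VV\<close> yields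
    the finite measure of \<open>\<Omega>\<close> and the positivity of \<Lambda>.\<close>
  have v11: "v 1 0 \<in> VV" using measured_fields(1)[of 1 0] by simp
  have \<Omega>: "\<Omega> \<in> lmeasurable"
    using lmeasurable_if_L2_displacement[OF S fields(2)[OF v11] _ fields(3)[OF v11] detL[OF v11]]
      VL2 v11 fields(1) by blast
  obtain \<xi>\<^sub>0 where "\<xi>\<^sub>0 \<in> \<Omega>" using domain(3) by blast
  then have "ereal 0 \<le> Lambda_sup \<Omega> VV"
    unfolding Lambda_sup_def by (intro SUP_upper2[OF v11] SUP_upper2[of \<xi>\<^sub>0]) auto
  then have \<Lambda>: "0 < \<Lambda>" using steps(1) by (metis ereal_less(2) less_ereal.simps(1) order_le_less_trans)
  then have \<sigma>t: "0 < \<sigma>t" using steps by simp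
  have "0 \<le> \<tau> * \<sigma> * (op_norm \<Omega> X D)\<^sup>2 / (1 - \<kappa>)" using steps by simp
  then have "\<Lambda> \<le> 1 + \<tau>" using steps(8) by linarith
  \<comment> \<open>Composition costs only the square root of \<Lambda>, so it suffices that
    \<open>1 + \<tau>\<close> lies below its own square.\<close>
  moreover have "1 + \<tau> < (1 + \<tau>)\<^sup>2" using steps(4) by (simp add: power2_eq_square algebra_simps add_pos_pos)
  ultimately have "sqrt \<Lambda> < 1 + \<tau>" using steps(4) by (intro real_less_lsqrt) auto
  define q where "q = sqrt \<Lambda> / (1 + \<tau>)"
  have q: "0 \<le> q" "q < 1"
    using \<Lambda> \<open>sqrt \<Lambda> < 1 + \<tau>\<close> steps(4) by (auto simp: q_def)
  obtain C where C: "C \<ge> 0" "\<And>y. y \<in> Y \<Longrightarrow> L2_norm \<Omega> (Dadj y) \<le> C * L2_norm \<Omega> y"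
    using adjoint_op_bounded[OF spaces(1,2) operator] by blast
  define R where "R = C * sqrt (measure lebesgue \<Omega>)"
  \<comment> \<open>A single number \<open>s\<close> dominates every small quantity, uniformly in
    \<open>k\<close>. The bound \<open>\<delta> \<le> s\<close> is included because averages over
    \<open>N \<ge> 1 / \<delta>\<close> frames bring in \<open>1 / N \<le> \<delta>\<close>.\<close>
  define good where "good \<delta> s \<longleftrightarrow> 0 < \<delta> \<and> \<delta> \<le> s \<and> \<alpha> \<delta> \<le> s \<and>
      (\<forall>k. L2_norm \<Omega> (\<lambda>\<xi>. b \<delta> k \<xi> - bbar k \<xi>) \<le> s) \<and>
      (\<forall>k. L2_norm \<Omega> (\<lambda>\<xi>. v \<delta> k \<xi> - vbar k \<xi>) \<le> s)" for \<delta> s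
  define e where "e \<delta> k = L2_norm \<Omega> (\<lambda>\<xi>. x \<delta> k \<xi> - bbar k \<xi>)" for \<delta> k
  define d where "d \<delta> k = L2_norm \<Omega> (\<lambda>\<xi>. x \<delta> (Suc k) \<xi> - x \<delta> k (v \<delta> k \<xi>))" for \<delta> k
  define e\<^sub>0 where "e\<^sub>0 = L2_norm \<Omega> (\<lambda>\<xi>. x0 \<xi> - bbar 0 \<xi>)"
  \<comment> \<open>The three summands stem from displacement noise, image noise and the dual
    variable, in this order.\<close>
  define c where "c = (sqrt M + \<tau> + \<tau> * R) / (1 + \<tau>)"
  \<comment> \<open>\<open>A\<close> and \<open>B\<close> are chosen to bound both
    \<open>e \<delta> (Suc k)\<close> and \<open>d \<delta> k\<close>; the factor
    \<open>1 + sqrt \<Lambda>\<close> arises because \<open>d\<close> combines a new error with a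
    transported old one.\<close>
  define A where "A = (1 + sqrt \<Lambda>) * e\<^sub>0"
  define B where "B = (1 + sqrt \<Lambda>) * (c / (1 - q)) + sqrt M"
  have pos: "0 \<le> R" "0 \<le> c" "0 \<le> e\<^sub>0" "0 \<le> A" "0 \<le> B"
    using C(1) comparison(1) steps(4) \<Lambda> q by (auto simp: R_def c_def A_def B_def e\<^sub>0_def)
  note L2X = fin_dim_L2[OF spaces(1)]
  have xX: "x \<delta> k \<in> X" if "\<delta> > 0" for \<delta> k
  proof (cases k)
    case 0
    then show ?thesis using that initial by simp
  next
    case (Suc j)
    then show ?thesis
      using algorithm[OF that] unfolding POPD_def is_prox_def is_arg_min_def by blast
  qed
  have xvX: "(\<lambda>\<xi>. x \<delta> k (v \<delta> k \<xi>)) \<in> X" if "\<delta> > 0" for \<delta> k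
    using measured_fields(2)[OF that xX[OF that]] by (simp add: o_def)
  have transport: "L2_norm \<Omega> (\<lambda>\<xi>. x \<delta> k (v \<delta> k \<xi>) - bbar (Suc k) \<xi>) \<le> sqrt \<Lambda> * e \<delta> k + sqrt M * s"
    if g: "good \<delta> s" for \<delta> s k
  proof -
    have \<delta>: "\<delta> > 0" using g by (simp add: good_def)
    \<comment> \<open>The comparison sequence may vary with \<delta> through \<alpha>. The Lipschitz
      bound is available for its continuous images \<open>xb k\<close>, with which
      \<open>bbar k\<close> agrees almost everywhere on \<open>\<Omega>\<close>.\<close>
    obtain xb yb where xy: "(xb, yb) \<in> comparison_set \<Omega> X Y D M U0 vbar \<sigma>t \<rho>t (\<alpha> \<delta>)"
      and bb: "\<And>k. ae_eq \<Omega> (bbar k) (xb k)"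
      using truth[OF \<delta>] unfolding image_comparison_set_def by blast
    from xy have xb: "xb k \<in> X" "continuous_on UNIV (xb k)"
      "\<exists>g. H1_gradient (xb k) g \<and> (norm_2_inf UNIV g)\<^sup>2 \<le> ereal M"
      "ae_eq UNIV (xb (Suc k)) (xb k \<circ> vbar k)" for k
      unfolding comparison_set_def by blast+
    have vb: "v \<delta> k \<in> VV" using measured_fields(1)[OF \<delta>] .
    have "AE \<xi> in lebesgue_on \<Omega>. xb (Suc k) \<xi> = (xb k \<circ> vbar k) \<xi>"
      using xb(4)[of k] S unfolding ae_eq_def lebesgue_on_UNIV_eq
      by (auto simp: AE_restrict_space_iff elim: AE_mp)
    with bb[of "Suc k"] have z: "ae_eq \<Omega> (bbar (Suc k)) (xb k \<circ> vbar k)"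
      unfolding ae_eq_def by eventually_elim simp
    have "L2_norm \<Omega> (\<lambda>\<xi>. x \<delta> k (v \<delta> k \<xi>) - bbar (Suc k) \<xi>)
        \<le> sqrt \<Lambda> * L2_norm \<Omega> (\<lambda>\<xi>. x \<delta> k \<xi> - xb k \<xi>) + sqrt M * L2_norm \<Omega> (\<lambda>\<xi>. v \<delta> k \<xi> - vbar k \<xi>)"
    proof (rule transport_error[OF S fields(2)[OF vb] fields(3)[OF vb] detL[OF vb]])
      show "\<bar>xb k a - xb k c\<bar> \<le> sqrt M * norm (a - c)" for a c
        using xb(2,3)[of k] comparison_Lipschitz by blast
    qed (use L2X xX[OF \<delta>] xb(1) measured_fields(2)[OF \<delta>] true_data VL2 fields(1) vb z in blast)+
    also have "L2_norm \<Omega> (\<lambda>\<xi>. x \<delta> k \<xi> - xb k \<xi>) = e \<delta> k"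
      unfolding e_def
    proof (rule L2_norm_cong)
      show "ae_eq \<Omega> (\<lambda>\<xi>. x \<delta> k \<xi> - xb k \<xi>) (\<lambda>\<xi>. x \<delta> k \<xi> - bbar k \<xi>)"
        using bb[of k] unfolding ae_eq_def by eventually_elim simp
    qed (use xX[OF \<delta>] xb(1) true_data(1) L2X in \<open>blast intro: L2_D(1) L2_diff\<close>)+
    also have "sqrt M * L2_norm \<Omega> (\<lambda>\<xi>. v \<delta> k \<xi> - vbar k \<xi>) \<le> sqrt M * s"
      using g comparison(1) by (intro mult_left_mono) (auto simp: good_def)
    finally show ?thesis by simp
  qed
  have recursion: "e \<delta> (Suc k) \<le> q * e \<delta> k + c * s" if g: "good \<delta> s" for \<delta> s k
  proof -
    have \<delta>: "\<delta> > 0" using g by (simp add: good_def)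
    obtain \<upsilon> where \<upsilon>:
      "is_prox \<Omega> Y (\<lambda>z. ereal \<sigma>t * Gconj_pred \<Omega> Y (\<alpha> \<delta>) \<rho>t z)
          (\<lambda>\<xi>. y \<delta> k (v \<delta> k \<xi>) + \<sigma>t *\<^sub>R D (x \<delta> k \<circ> v \<delta> k) \<xi>) \<upsilon>"
      "is_prox \<Omega> X (\<lambda>z. ereal \<tau> * Ffun \<Omega> (b \<delta> (Suc k)) z)
          (\<lambda>\<xi>. x \<delta> k (v \<delta> k \<xi>) - \<tau> * Dadj \<upsilon> \<xi>) (x \<delta> (Suc k))"
      using algorithm[OF \<delta>] unfolding POPD_def by blast
    have \<upsilon>Y: "\<upsilon> \<in> Y" using \<upsilon>(1) unfolding is_prox_def is_arg_min_def by blast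
    have "L2_norm \<Omega> \<upsilon> \<le> \<bar>\<alpha> \<delta>\<bar> * sqrt (measure lebesgue \<Omega>)"
      using prox_Gconj_pred_in_scaled_dual_ball[OF spaces(2) \<sigma>t \<upsilon>(1)] L2_norm_scaled_dual_ball_le[OF \<Omega>]
      by blast
    also have "\<dots> \<le> s * sqrt (measure lebesgue \<Omega>)"
      using g alpha(1)[OF \<delta>] by (intro mult_right_mono) (auto simp: good_def)
    finally have "C * L2_norm \<Omega> \<upsilon> \<le> C * (s * sqrt (measure lebesgue \<Omega>))"
      using C(1) by (rule mult_left_mono)
    then have "C * L2_norm \<Omega> \<upsilon> \<le> R * s" by (simp add: R_def mult_ac)
    then have dual: "L2_norm \<Omega> (Dadj \<upsilon>) \<le> R * s" using C(2)[OF \<upsilon>Y] by linarith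
    have Dadj: "Dadj \<upsilon> \<in> X" using operator(2) \<upsilon>Y unfolding adjoint_op_def by blast
    have "e \<delta> (Suc k) \<le> (L2_norm \<Omega> (\<lambda>\<xi>. x \<delta> k (v \<delta> k \<xi>) - bbar (Suc k) \<xi>)
        + \<tau> * L2_norm \<Omega> (\<lambda>\<xi>. b \<delta> (Suc k) \<xi> - bbar (Suc k) \<xi>) + \<tau> * L2_norm \<Omega> (Dadj \<upsilon>)) / (1 + \<tau>)"
      unfolding e_def
      by (rule prox_Ffun_error[OF spaces(1) steps(4) xvX[OF \<delta>] Dadj measured_images[OF \<delta>] true_data(1) \<upsilon>(2)])
    also have "\<dots> \<le> ((sqrt \<Lambda> * e \<delta> k + sqrt M * s) + \<tau> * s + \<tau> * (R * s)) / (1 + \<tau>)"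
      using transport[OF g, of k] g dual steps(4)
      by (intro divide_right_mono add_mono mult_left_mono) (auto simp: good_def)
    also have "\<dots> = q * e \<delta> k + c * s"
      by (simp add: q_def c_def add_divide_distrib algebra_simps)
    finally show ?thesis .
  qed
  \<comment> \<open>All runs start at \<open>x0\<close>, so \<open>e \<delta> 0\<close> is
    \<open>e\<^sub>0\<close> for every positive \<delta> and the transient term is independent of
    \<delta>.\<close>
  have e_bound: "e \<delta> k \<le> e\<^sub>0 * q ^ k + c / (1 - q) * s" if g: "good \<delta> s" for \<delta> s k
  proof -
    have "\<delta> > 0" "s \<ge> 0" using g by (auto simp: good_def)
    then show ?thesis
      using affine_contraction_bound[where e = "e \<delta>", OF q _ recursion[OF g], of k] pos(2) initial(3)
      by (simp add: e_def e\<^sub>0_def)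
  qed
  have e_Suc: "e \<delta> (Suc k) \<le> e\<^sub>0 * q ^ k + c / (1 - q) * s" if g: "good \<delta> s" for \<delta> s k
  proof -
    have "q ^ Suc k \<le> q ^ k" using q by (intro power_decreasing) auto
    then have "e\<^sub>0 * q ^ Suc k \<le> e\<^sub>0 * q ^ k" using pos(3) by (rule mult_left_mono)
    then show ?thesis using e_bound[OF g, of "Suc k"] by linarith
  qed
  have ed: "e \<delta> (Suc k) \<le> A * q ^ k + B * s" "d \<delta> k \<le> A * q ^ k + B * s" if g: "good \<delta> s" for \<delta> s k
  proof -
    have \<delta>: "\<delta> > 0" "s \<ge> 0" using g by (auto simp: good_def)
    define E where "E = e\<^sub>0 * q ^ k + c / (1 - q) * s"
    have AB: "A * q ^ k + B * s = E + sqrt \<Lambda> * E + sqrt M * s"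
      by (simp add: A_def B_def E_def add_divide_distrib algebra_simps)
    have "0 \<le> E" using pos q \<delta> by (auto simp: E_def)
    then show "e \<delta> (Suc k) \<le> A * q ^ k + B * s"
      unfolding AB using e_Suc[OF g, of k, folded E_def] \<delta> \<Lambda> comparison(1)
      by (simp add: add_increasing2)
    \<comment> \<open>The increment is split at the true image of frame \<open>Suc k\<close>, near
      which both the new iterate and the transported old one lie.\<close>
    have "d \<delta> k \<le> e \<delta> (Suc k) + L2_norm \<Omega> (\<lambda>\<xi>. bbar (Suc k) \<xi> - x \<delta> k (v \<delta> k \<xi>))"
      unfolding d_def e_def using xX[OF \<delta>(1)] xvX[OF \<delta>(1)] true_data(1) L2X
      by (intro L2_norm_diff_triangle) auto
    also have "\<dots> \<le> E + (sqrt \<Lambda> * E + sqrt M * s)"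
    proof -
      have "sqrt \<Lambda> * e \<delta> k \<le> sqrt \<Lambda> * E"
        using e_bound[OF g, of k, folded E_def] \<Lambda> by (intro mult_left_mono) auto
      then show ?thesis
        using e_Suc[OF g, of k, folded E_def] transport[OF g, of k]
          L2_norm_minus_commute[of \<Omega> "bbar (Suc k)" "\<lambda>\<xi>. x \<delta> k (v \<delta> k \<xi>)"] by linarith
    qed
    finally show "d \<delta> k \<le> A * q ^ k + B * s" unfolding AB by simp
  qed
  have eventually_good: "\<forall>\<^sub>F \<delta> in at_right 0. good \<delta> s" if "s > 0" for s
  proof -
    have ident: "((\<lambda>\<delta>::real. \<delta>) \<longlongrightarrow> 0) (at_right 0)" by (rule tendsto_ident_at)
    have s: "(0::ereal) < ereal s" using that by simp
    show ?thesis
      using eventually_at_right_less[of "0::real"] order_tendstoD(2)[OF ident that]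
        order_tendstoD(2)[OF alpha(2) that] order_tendstoD(2)[OF noise(1) s] order_tendstoD(2)[OF noise(2) s]
    proof eventually_elim
      case (elim \<delta>)
      have "L2_norm \<Omega> (\<lambda>\<xi>. b \<delta> k \<xi> - bbar k \<xi>) \<le> s" for k
        using SUP_lessD[OF elim(4), of k] by simp
      moreover have "L2_norm \<Omega> (\<lambda>\<xi>. v \<delta> k \<xi> - vbar k \<xi>) \<le> s" for k
        using SUP_lessD[OF elim(5), of k] by simp
      ultimately show ?case using elim(1-3) by (simp add: good_def)
    qed
  qed
  \<comment> \<open>Averaging over at least \<open>1 / \<delta>\<close> frames makes the transient
    contribution vanish together with the noise.\<close>
  define Nbar where "Nbar \<delta> = nat \<lceil>1 / \<delta>\<rceil>" for \<delta> :: real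
  define P where "P s = 2 * A\<^sup>2 / (1 - q) * s + 2 * (B * s)\<^sup>2" for s
  have mean: "1 / real N * (\<Sum>k<N. (f k)\<^sup>2) \<le> P s"
    if g: "good \<delta> s" and N: "N \<ge> Nbar \<delta>" and f: "\<And>k. 0 \<le> f k" "\<And>k. f k \<le> A * q ^ k + B * s" for f \<delta> s N
  proof -
    have \<delta>: "\<delta> > 0" "\<delta> \<le> s" using g by (auto simp: good_def)
    have N': "1 / \<delta> \<le> real N" using N by (simp add: Nbar_def)
    moreover have "0 < 1 / \<delta>" using \<delta>(1) by simp
    ultimately have "0 < real N" by linarith
    moreover have "1 \<le> real N * \<delta>" using N' \<delta>(1) by (simp add: pos_divide_le_eq)
    ultimately have "1 / real N \<le> \<delta>" by (simp add: pos_divide_le_eq mult.commute)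
    then have "1 / real N \<le> s" using \<delta>(2) by linarith
    then have "2 * A\<^sup>2 / (1 - q) * (1 / real N) \<le> 2 * A\<^sup>2 / (1 - q) * s"
      using q by (intro mult_left_mono) auto
    then show ?thesis
      using mean_square_geometric_bound[OF q f, of N] \<open>0 < real N\<close> by (simp add: P_def)
  qed
  have lim: "((\<lambda>\<delta>. SUP N\<in>{Nbar \<delta>..}. ereal (\<Phi> \<delta> N)) \<longlongrightarrow> 0) (at_right 0)"
    if nn: "\<And>\<delta> N. 0 \<le> \<Phi> \<delta> N" and le: "\<And>\<delta> s N. good \<delta> s \<Longrightarrow> N \<ge> Nbar \<delta> \<Longrightarrow> \<Phi> \<delta> N \<le> P s" for \<Phi>
  proof (rule SUP_tendsto_0[OF nn])
    fix \<epsilon> :: real assume "\<epsilon> > 0"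
    \<comment> \<open>\<open>P s \<le> s * Q\<close> whenever \<open>s \<le> 1\<close>; the summand
      1 keeps \<open>Q\<close> positive for the division.\<close>
    define Q where "Q = 2 * A\<^sup>2 / (1 - q) + 2 * B\<^sup>2 + 1"
    define s where "s = min 1 (\<epsilon> / Q)"
    have Q: "Q > 0" using q by (auto simp: Q_def intro!: add_nonneg_pos)
    then have s: "0 < s" "s \<le> 1" "s * Q \<le> \<epsilon>" using \<open>\<epsilon> > 0\<close> by (auto simp: s_def min_def field_simps)
    have "B\<^sup>2 * (s * s) \<le> B\<^sup>2 * s" using s by (intro mult_left_mono mult_left_le) auto
    then have "P s \<le> s * Q"
      using s by (simp add: P_def Q_def power_mult_distrib power2_eq_square algebra_simps)
    then have P: "P s \<le> \<epsilon>" using s by linarith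
    show "\<forall>\<^sub>F \<delta> in at_right 0. \<forall>N\<ge>Nbar \<delta>. \<Phi> \<delta> N \<le> \<epsilon>"
      using eventually_good[OF s(1)] by eventually_elim (meson P le order_trans)
  qed
  have "((\<lambda>\<delta>. SUP N\<in>{Nbar \<delta>..}.
         ereal (1 / real N * (\<Sum>k = 1..N. (L2_norm \<Omega> (\<lambda>\<xi>. x \<delta> k \<xi> - bbar k \<xi>))\<^sup>2)))
       \<longlongrightarrow> 0) (at_right 0)"
  proof (rule lim)
    fix \<delta> s N assume "good \<delta> s" "N \<ge> Nbar \<delta>"
    \<comment> \<open>The sum over frames 1 to \<open>N\<close> is the sum of
      \<open>e \<delta> (Suc k)\<close> over \<open>k < N\<close>.\<close>
    from mean[OF this _ ed(1)] this
    show "1 / real N * (\<Sum>k = 1..N. (L2_norm \<Omega> (\<lambda>\<xi>. x \<delta> k \<xi> - bbar k \<xi>))\<^sup>2) \<le> P s"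
      by (simp add: e_def sum.atLeast1_atMost_eq)
  qed (auto intro!: divide_nonneg_nonneg sum_nonneg)
  moreover have "((\<lambda>\<delta>. SUP N\<in>{Nbar \<delta>..}.
           ereal (1 / (2 * real N) *
             (\<Sum>k<N. (L2_norm \<Omega> (\<lambda>\<xi>. x \<delta> (Suc k) \<xi> - x \<delta> k (v \<delta> k \<xi>)))\<^sup>2)))
         \<longlongrightarrow> 0) (at_right 0)"
  proof (rule lim)
    fix \<delta> s N assume g: "good \<delta> s" "N \<ge> Nbar \<delta>"
    \<comment> \<open>In the case \<open>N = 0\<close> both sides are 0, as division by 0 yields
      0.\<close>
    have "1 / (2 * real N) * (\<Sum>k<N. (d \<delta> k)\<^sup>2) \<le> 1 / real N * (\<Sum>k<N. (d \<delta> k)\<^sup>2)"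
      by (intro mult_right_mono sum_nonneg) (cases "N = 0", auto simp: field_simps)
    also have "\<dots> \<le> P s" by (rule mean[OF g _ ed(2)[OF g(1)]]) (simp add: d_def)
    finally show "1 / (2 * real N) *
             (\<Sum>k<N. (L2_norm \<Omega> (\<lambda>\<xi>. x \<delta> (Suc k) \<xi> - x \<delta> k (v \<delta> k \<xi>)))\<^sup>2) \<le> P s"
      by (simp add: d_def)
  qed (auto intro!: divide_nonneg_nonneg sum_nonneg)
  ultimately show ?thesis by blast
qed

end
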